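(* Let $\Bbbk$ be a field, let $H$ be an associative unital $\Bbbk$-algebra, and let $\mathscr C$ be a full abelian subcategory of the category of left $H$-modules, closed under submodules, all of whose objects are finite dimensional over $\Bbbk$. Then the map $K_0(\mathscr C)\to\mathcal Z_{\mathscr C}$ given by $|V|\mapsto z_V$ for every object $V$ of $\mathscr C$ is an isomorphism of abelian groups.
   Context: For a finite dimensional left $H$-module $V$ (action denoted $\triangleright$), with dual $V^\star=V^*=\mathrm{Hom}_\Bbbk(V,\Bbbk)$, let $1_V\in V\otimes V^*$ be the canonical element corresponding to $\mathrm{id}_V$ (the unity of the algebra $V\otimes V^*\cong\mathrm{End}_\Bbbk V$), and let $\beta_V(v\otimes f)\in H^*=\mathrm{Hom}_\Bbbk(H,\Bbbk)$ be the matrix coefficient $h\mapsto f(h\triangleright v)$. Set $z_V:=\beta_V(1_V)\in H^*$; thus $z_V(h)$ is the trace of the action of $h$ on $V$. Define $\mathcal Z_{\mathscr C}=\sum_V\mathbb Z z_V\subseteq H^*$, the sum being over isomorphism classes of objects $V$ of $\mathscr C$. $K_0(\mathscr C)$ is the Grothendieck group of the abelian category $\mathscr C$ (relations given by short exact sequences) and $|V|$ is the class of $V$ in it.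
   Formalization: The field is additionally assumed to have characteristic 0; in characteristic p the claim fails whenever the category has a nonzero object V, since p|V| is nonzero in the Grothendieck group while p z_V = 0. *)

theory Defs
  imports Complex_Main "HOL-Algebra.Module" "HOL-Algebra.Free_Abelian_Groups"
begin

section \<open>Algebras and their left modules\<close>

text \<open>
  The sort \<open>{ring, monoid_mult}\<close> is that of associative unital rings; unlike \<open>ring_1\<close> it does
  not exclude the zero ring.
\<close>

locale assoc_algebra = vector_space scale
  for scale :: "'k::field \<Rightarrow> 'h::{ring,monoid_mult} \<Rightarrow> 'h" +
  assumes scale_mult_left: "scale c x * y = scale c (x * y)"
    and scale_mult_right: "x * scale c y = scale c (x * y)"

text \<open>
  The library's locale \<open>module\<close> is restricted to commutative rings of scalars, so left modules over
  the (noncommutative) ring \<open>'h\<close> are introduced on its record type.  The fields \<open>mult\<close> and \<open>one\<close>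
  which that record inherits from \<open>ring\<close> play no role.
\<close>

locale left_module = abelian_group V
  for V :: "('h::{ring,monoid_mult}, 'v) module" (structure) +
  assumes act_closed: "v \<in> carrier V \<Longrightarrow> h \<odot> v \<in> carrier V"
    and act_add_left: "v \<in> carrier V \<Longrightarrow> (g + h) \<odot> v = (g \<odot> v) \<oplus> (h \<odot> v)"
    and act_add_right:
      "\<lbrakk>v \<in> carrier V; w \<in> carrier V\<rbrakk> \<Longrightarrow> h \<odot> (v \<oplus> w) = (h \<odot> v) \<oplus> (h \<odot> w)"
    and act_mult: "v \<in> carrier V \<Longrightarrow> (g * h) \<odot> v = g \<odot> (h \<odot> v)"
    and act_one: "v \<in> carrier V \<Longrightarrow> 1 \<odot> v = v"

definition is_submodule :: "'v set \<Rightarrow> ('h, 'v) module \<Rightarrow> bool" where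
  "is_submodule U V \<longleftrightarrow>
     subgroup U (add_monoid V) \<and> (\<forall>h. \<forall>u\<in>U. h \<odot>\<^bsub>V\<^esub> u \<in> U)"

text \<open>
  Morphisms are taken extensional, so that equality of functions is equality of morphisms and
  \<open>\<exists>!\<close> can be used in universal properties.
\<close>

definition Hom :: "('h, 'v) module \<Rightarrow> ('h, 'v) module \<Rightarrow> ('v \<Rightarrow> 'v) set" where
  "Hom V W = {f \<in> hom (add_monoid V) (add_monoid W) \<inter> extensional (carrier V).
     \<forall>h. \<forall>v\<in>carrier V. f (h \<odot>\<^bsub>V\<^esub> v) = h \<odot>\<^bsub>W\<^esub> f v}"

definition id_mor :: "('h, 'v) module \<Rightarrow> 'v \<Rightarrow> 'v" where
  "id_mor V = (\<lambda>v\<in>carrier V. v)"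

definition zero_mor :: "('h, 'v) module \<Rightarrow> ('h, 'v) module \<Rightarrow> 'v \<Rightarrow> 'v" where
  "zero_mor V W = (\<lambda>v\<in>carrier V. \<zero>\<^bsub>W\<^esub>)"

definition add_mor ::
  "('h, 'v) module \<Rightarrow> ('h, 'v) module \<Rightarrow> ('v \<Rightarrow> 'v) \<Rightarrow> ('v \<Rightarrow> 'v) \<Rightarrow> 'v \<Rightarrow> 'v" where
  "add_mor V W f g = (\<lambda>v\<in>carrier V. f v \<oplus>\<^bsub>W\<^esub> g v)"


section \<open>Full abelian subcategories\<close>

text \<open>
  A full subcategory is given by its set \<open>C\<close> of objects, modules with carriers in an arbitrary
  universe \<open>'v\<close>.  It need not contain every isomorphic copy of its objects.  All notions
  below are internal to \<open>C\<close>: test objects range over \<open>C\<close> only.  The composite of \<open>f\<close> after \<open>g\<close> with \<open>g\<close> defined on \<open>T\<close> is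
  \<open>compose (carrier T) f g\<close>.
\<close>

definition is_zero_object :: "('h, 'v) module set \<Rightarrow> ('h, 'v) module \<Rightarrow> bool" where
  "is_zero_object C Z \<longleftrightarrow>
     Z \<in> C \<and> (\<forall>V\<in>C. (\<exists>!f. f \<in> Hom V Z) \<and> (\<exists>!f. f \<in> Hom Z V))"

definition is_biproduct ::
  "('h, 'v) module set \<Rightarrow> ('h, 'v) module \<Rightarrow> ('h, 'v) module \<Rightarrow> ('h, 'v) module \<Rightarrow> bool" where
  "is_biproduct C V W P \<longleftrightarrow> P \<in> C \<and>
     (\<exists>i\<in>Hom V P. \<exists>j\<in>Hom W P. \<exists>p\<in>Hom P V. \<exists>q\<in>Hom P W.
        compose (carrier V) p i = id_mor V \<and> compose (carrier W) q j = id_mor W \<and>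
        add_mor P P (compose (carrier P) i p) (compose (carrier P) j q) = id_mor P)"

definition is_kernel ::
  "('h, 'v) module set \<Rightarrow> ('h, 'v) module \<Rightarrow> ('h, 'v) module \<Rightarrow> ('v \<Rightarrow> 'v) \<Rightarrow>
   ('h, 'v) module \<Rightarrow> ('v \<Rightarrow> 'v) \<Rightarrow> bool" where
  "is_kernel C V W f K k \<longleftrightarrow> K \<in> C \<and> k \<in> Hom K V \<and>
     compose (carrier K) f k = zero_mor K W \<and>
     (\<forall>T\<in>C. \<forall>g\<in>Hom T V. compose (carrier T) f g = zero_mor T W \<longrightarrow>
        (\<exists>!u. u \<in> Hom T K \<and> compose (carrier T) k u = g))"

definition is_cokernel ::
  "('h, 'v) module set \<Rightarrow> ('h, 'v) module \<Rightarrow> ('h, 'v) module \<Rightarrow> ('v \<Rightarrow> 'v) \<Rightarrow>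
   ('h, 'v) module \<Rightarrow> ('v \<Rightarrow> 'v) \<Rightarrow> bool" where
  "is_cokernel C V W f Q q \<longleftrightarrow> Q \<in> C \<and> q \<in> Hom W Q \<and>
     compose (carrier V) q f = zero_mor V Q \<and>
     (\<forall>T\<in>C. \<forall>g\<in>Hom W T. compose (carrier V) g f = zero_mor V T \<longrightarrow>
        (\<exists>!u. u \<in> Hom Q T \<and> compose (carrier W) u q = g))"

definition is_mono ::
  "('h, 'v) module set \<Rightarrow> ('h, 'v) module \<Rightarrow> ('v \<Rightarrow> 'v) \<Rightarrow> bool" where
  "is_mono C V f \<longleftrightarrow> (\<forall>T\<in>C. \<forall>g\<in>Hom T V. \<forall>g'\<in>Hom T V.
     compose (carrier T) f g = compose (carrier T) f g' \<longrightarrow> g = g')"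

definition is_epi ::
  "('h, 'v) module set \<Rightarrow> ('h, 'v) module \<Rightarrow> ('h, 'v) module \<Rightarrow> ('v \<Rightarrow> 'v) \<Rightarrow> bool" where
  "is_epi C V W f \<longleftrightarrow> (\<forall>T\<in>C. \<forall>g\<in>Hom W T. \<forall>g'\<in>Hom W T.
     compose (carrier V) g f = compose (carrier V) g' f \<longrightarrow> g = g')"

locale full_abelian_subcategory =
  fixes C :: "('h::{ring,monoid_mult}, 'v) module set"
  assumes objects: "V \<in> C \<Longrightarrow> left_module V"
    and zero_object: "\<exists>Z. is_zero_object C Z"
    and biproducts: "\<lbrakk>V \<in> C; W \<in> C\<rbrakk> \<Longrightarrow> \<exists>P. is_biproduct C V W P"
    and kernels: "\<lbrakk>V \<in> C; W \<in> C; f \<in> Hom V W\<rbrakk> \<Longrightarrow> \<exists>K k. is_kernel C V W f K k"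
    and cokernels: "\<lbrakk>V \<in> C; W \<in> C; f \<in> Hom V W\<rbrakk> \<Longrightarrow> \<exists>Q q. is_cokernel C V W f Q q"
    and monos_normal: "\<lbrakk>V \<in> C; W \<in> C; f \<in> Hom V W; is_mono C V f\<rbrakk> \<Longrightarrow>
      \<exists>T\<in>C. \<exists>g\<in>Hom W T. is_kernel C W T g V f"
    and epis_conormal: "\<lbrakk>V \<in> C; W \<in> C; f \<in> Hom V W; is_epi C V W f\<rbrakk> \<Longrightarrow>
      \<exists>T\<in>C. \<exists>g\<in>Hom T V. is_cokernel C T V g W f"

definition closed_under_submodules :: "('h, 'v) module set \<Rightarrow> bool" where
  "closed_under_submodules C \<longleftrightarrow>
     (\<forall>V\<in>C. \<forall>U. is_submodule U V \<longrightarrow> V\<lparr>carrier := U\<rparr> \<in> C)"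


section \<open>The Grothendieck group\<close>

definition short_exact ::
  "('h, 'v) module set \<Rightarrow> ('h, 'v) module \<Rightarrow> ('h, 'v) module \<Rightarrow> ('h, 'v) module \<Rightarrow> bool" where
  "short_exact C U V W \<longleftrightarrow> (\<exists>f\<in>Hom U V. \<exists>g\<in>Hom V W.
     is_kernel C V W g U f \<and> is_cokernel C U V f W g)"

text \<open>
  Generators are all objects of \<open>C\<close>; isomorphic objects are identified by the relations, since
  \<open>0 \<rightarrow> U \<rightarrow> V \<rightarrow> 0 \<rightarrow> 0\<close> is exact for \<open>U\<close> isomorphic to \<open>V\<close>.
\<close>

definition K0_relations :: "('h, 'v) module set \<Rightarrow> (('h, 'v) module \<Rightarrow>\<^sub>0 int) set" where
  "K0_relations C = generate (free_Abelian_group C)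
     {frag_of V - frag_of U - frag_of W |U V W.
        U \<in> C \<and> V \<in> C \<and> W \<in> C \<and> short_exact C U V W}"

definition K0 :: "('h, 'v) module set \<Rightarrow> (('h, 'v) module \<Rightarrow>\<^sub>0 int) set monoid" where
  "K0 C = free_Abelian_group C Mod K0_relations C"

definition K0_class ::
  "('h, 'v) module set \<Rightarrow> ('h, 'v) module \<Rightarrow> (('h, 'v) module \<Rightarrow>\<^sub>0 int) set" where
  "K0_class C V = K0_relations C #>\<^bsub>free_Abelian_group C\<^esub> frag_of V"


section \<open>Matrix coefficients and the elements \<open>z\<^sub>V\<close>\<close>

context assoc_algebra
begin

text \<open>The vector space structure of an \<open>H\<close>-module is the one induced by \<open>c \<mapsto> c 1\<^sub>H\<close>.\<close>

definition scal :: "('h, 'v) module \<Rightarrow> 'k \<Rightarrow> 'v \<Rightarrow> 'v" where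
  "scal V c v = scale c 1 \<odot>\<^bsub>V\<^esub> v"

definition finite_dimensional :: "('h, 'v) module \<Rightarrow> bool" where
  "finite_dimensional V \<longleftrightarrow> (\<exists>B. finite B \<and> B \<subseteq> carrier V \<and>
     (\<forall>v\<in>carrier V. \<exists>c. v = (\<Oplus>\<^bsub>V\<^esub>b\<in>B. scal V (c b) b)))"

text \<open>Values outside the carrier are irrelevant and left unconstrained.\<close>

definition dual_space :: "('h, 'v) module \<Rightarrow> ('v \<Rightarrow> 'k) set" where
  "dual_space V = {f.
     (\<forall>v\<in>carrier V. \<forall>w\<in>carrier V. f (v \<oplus>\<^bsub>V\<^esub> w) = f v + f w) \<and>
     (\<forall>c. \<forall>v\<in>carrier V. f (scal V c v) = c * f v)}"

definition matrix_coeff :: "('h, 'v) module \<Rightarrow> 'v \<Rightarrow> ('v \<Rightarrow> 'k) \<Rightarrow> 'h \<Rightarrow> 'k" where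
  "matrix_coeff V v f h = f (h \<odot>\<^bsub>V\<^esub> v)"

text \<open>
  A list of pairs \<open>(v, f)\<close> stands for the element \<open>\<Sum> v \<otimes> f\<close> of the tensor product of \<open>V\<close> with its
  dual.  It represents the canonical element iff the corresponding endomorphism
  \<open>x \<mapsto> \<Sum> f(x) v\<close> is the identity.
\<close>

definition represents_unit :: "('h, 'v) module \<Rightarrow> ('v \<times> ('v \<Rightarrow> 'k)) list \<Rightarrow> bool" where
  "represents_unit V t \<longleftrightarrow> set t \<subseteq> carrier V \<times> dual_space V \<and>
     (\<forall>x\<in>carrier V. (\<Oplus>\<^bsub>V\<^esub>i\<in>{..<length t}. scal V (snd (t ! i) x) (fst (t ! i))) = x)"

definition beta :: "('h, 'v) module \<Rightarrow> ('v \<times> ('v \<Rightarrow> 'k)) list \<Rightarrow> 'h \<Rightarrow> 'k" where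
  "beta V t h = (\<Sum>(v, f)\<leftarrow>t. matrix_coeff V v f h)"

definition z_elem :: "('h, 'v) module \<Rightarrow> 'h \<Rightarrow> 'k" where
  "z_elem V = beta V (SOME t. represents_unit V t)"

definition dual_group :: "('h \<Rightarrow> 'k) monoid" where
  "dual_group = \<lparr>carrier = {f. Vector_Spaces.linear scale (*) f},
     monoid.mult = (\<lambda>f g h. f h + g h), one = (\<lambda>h. 0)\<rparr>"

definition Z_group :: "('h, 'v) module set \<Rightarrow> ('h \<Rightarrow> 'k) monoid" where
  "Z_group C = subgroup_generated dual_group (z_elem ` C)"

end

end

theory Submission
  imports Defs
begin

text \<open>
  Closure under submodules makes exactness in \<open>C\<close> the usual exactness of modules: a monomorphism is
  injective, an epimorphism surjective since its image is the kernel of some morphism, and \<open>V/U\<close> is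
  realised as the image of a morphism with kernel \<open>U\<close>.  Traces are additive on exact sequences, so
  \<open>V \<mapsto> z\<^sub>V\<close> factors through the Grothendieck group.  Splitting off submodules shows that the
  latter is generated by the classes of simple objects, and it remains to see that the \<open>z\<^sub>S\<close> of
  pairwise nonisomorphic simple \<open>S\<close> are linearly independent over the integers.  Given finitely
  many such \<open>S\<close>, some \<open>e\<close> in the algebra acts as the identity on a chosen one and as zero on the
  others.  Evaluation at \<open>e\<close> isolates the coefficient of the chosen object, multiplied by its
  dimension, which is nonzero in characteristic zero.
\<close>

section \<open>Modules, submodules and morphisms\<close>

text \<open>Characteristic zero is essential: in characteristic p > 0 every \<open>z_elem S\<close>
  is killed by p, whereas the class of a simple object has infinite order in the Grothendieck group.
  Kernels, cokernels and exactness are tested against objects of \<open>C\<close> only, and a module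
  of cosets does not even have its elements in \<open>'v\<close>. Hence quotients have to be found
  inside objects already present. The field need not be algebraically closed and the algebra may be
  infinite dimensional, so simple objects need not be absolutely simple and no matrix algebra
  description is at hand. An element acting as 1 on one simple object and as 0 on finitely many
  others suffices instead; modulo the common annihilator it is a central idempotent, and it is
  produced by a density argument with left ideals that involves no scalars. Finally,
  \<open>z_elem\<close> rests on an arbitrary choice of a representation of the canonical element,
  so the trace must be freed from this choice before anything can be computed.\<close>

context left_module
begin

lemma minus_eq_zero_iff:
  assumes "v \<in> carrier V" "w \<in> carrier V"
  shows "v \<ominus> w = \<zero> \<longleftrightarrow> v = w"
proof
  assume "v \<ominus> w = \<zero>"
  then have "v \<oplus> \<ominus> w = w \<oplus> \<ominus> w"
    using assms by (simp add: a_minus_def r_neg)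
  then show "v = w"
    using assms by (simp only: add.right_cancel a_inv_closed)
qed (use assms in \<open>simp add: a_minus_def r_neg\<close>)

lemma act_zero_right: "h \<odot> \<zero> = \<zero>"
proof -
  have "h \<odot> \<zero> \<oplus> h \<odot> \<zero> = h \<odot> \<zero> \<oplus> \<zero>"
    using act_add_right[of \<zero> \<zero> h] act_closed[of \<zero> h] by simp
  then show ?thesis
    using act_closed[of \<zero> h] by simp
qed

lemma act_zero_left:
  assumes v: "v \<in> carrier V"
  shows "0 \<odot> v = \<zero>"
proof -
  have "0 \<odot> v \<oplus> 0 \<odot> v = 0 \<odot> v \<oplus> \<zero>"
    using act_add_left[OF v, of 0 0] act_closed[OF v] by simp
  then show ?thesis
    using act_closed[OF v] by simp
qed

lemma act_minus_left:
  assumes v: "v \<in> carrier V"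
  shows "(- h) \<odot> v = \<ominus> (h \<odot> v)"
proof -
  have "(- h) \<odot> v \<oplus> h \<odot> v = \<zero>"
    using act_add_left[OF v, of "- h" h] act_zero_left[OF v] by simp
  then show ?thesis
    using act_closed[OF v] by (simp add: minus_equality)
qed

lemma act_diff_eq_zero_iff:
  assumes "v \<in> carrier V"
  shows "(g - h) \<odot> v = \<zero> \<longleftrightarrow> g \<odot> v = h \<odot> v"
proof -
  have "(g - h) \<odot> v = g \<odot> v \<ominus> h \<odot> v"
    using act_add_left[OF assms, of g "- h"] assms by (simp add: act_minus_left a_minus_def)
  then show ?thesis
    using assms by (simp add: act_closed minus_eq_zero_iff)
qed

lemma act_finsum:
  assumes "finite A" "\<And>i. i \<in> A \<Longrightarrow> v i \<in> carrier V"
  shows "h \<odot> (\<Oplus>i\<in>A. v i) = (\<Oplus>i\<in>A. h \<odot> v i)"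
  using assms
proof (induction A rule: finite_induct)
  case empty
  then show ?case by (simp add: act_zero_right)
next
  case (insert a A)
  then have "v \<in> A \<rightarrow> carrier V" "(\<lambda>i. h \<odot> v i) \<in> A \<rightarrow> carrier V"
    by (auto simp: act_closed)
  with insert show ?case by (simp add: act_add_right act_closed)
qed

text \<open>Negatives come for free, since they are given by the action of
  \<open>- 1\<close>.\<close>

lemma is_submoduleI:
  assumes "U \<subseteq> carrier V" "\<zero> \<in> U"
    and add: "\<And>u w. \<lbrakk>u \<in> U; w \<in> U\<rbrakk> \<Longrightarrow> u \<oplus> w \<in> U"
    and act: "\<And>h u. u \<in> U \<Longrightarrow> h \<odot> u \<in> U"
  shows "is_submodule U V"
proof -
  have "\<ominus> u \<in> U" if "u \<in> U" for u
    using act[OF that, of "- 1"] that \<open>U \<subseteq> carrier V\<close> by (auto simp: act_minus_left act_one)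
  then have "subgroup U (add_monoid V)"
    using assms by unfold_locales (auto simp: a_inv_def[symmetric])
  then show ?thesis
    using act by (simp add: is_submodule_def)
qed

lemma is_submoduleD:
  assumes "is_submodule U V"
  shows "U \<subseteq> carrier V" "\<zero> \<in> U" "\<lbrakk>u \<in> U; w \<in> U\<rbrakk> \<Longrightarrow> u \<oplus> w \<in> U" "u \<in> U \<Longrightarrow> h \<odot> u \<in> U"
proof -
  have U: "subgroup U (add_monoid V)"
    using assms by (simp add: is_submodule_def)
  show "U \<subseteq> carrier V" "\<zero> \<in> U"
    using subgroup.subset[OF U] subgroup.one_closed[OF U] by auto
  show "\<lbrakk>u \<in> U; w \<in> U\<rbrakk> \<Longrightarrow> u \<oplus> w \<in> U"
    using subgroup.m_closed[OF U] by simp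
  show "u \<in> U \<Longrightarrow> h \<odot> u \<in> U"
    using assms by (simp add: is_submodule_def)
qed

lemma is_submodule_zero: "is_submodule {\<zero>} V"
  by (rule is_submoduleI) (auto simp: act_zero_right)

end

definition simple_module :: "('h::{ring,monoid_mult}, 'v) module \<Rightarrow> bool" where
  "simple_module V \<longleftrightarrow> left_module V \<and> carrier V \<noteq> {\<zero>\<^bsub>V\<^esub>} \<and>
     (\<forall>U. is_submodule U V \<longrightarrow> U = {\<zero>\<^bsub>V\<^esub>} \<or> U = carrier V)"

definition isomorphic :: "('h, 'v) module \<Rightarrow> ('h, 'v) module \<Rightarrow> bool" where
  "isomorphic V W \<longleftrightarrow> (\<exists>f\<in>Hom V W. bij_betw f (carrier V) (carrier W))"

lemma HomI:
  assumes "\<And>v. v \<in> carrier V \<Longrightarrow> f v \<in> carrier W"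
    and "\<And>v w. \<lbrakk>v \<in> carrier V; w \<in> carrier V\<rbrakk> \<Longrightarrow> f (v \<oplus>\<^bsub>V\<^esub> w) = f v \<oplus>\<^bsub>W\<^esub> f w"
    and "\<And>h v. v \<in> carrier V \<Longrightarrow> f (h \<odot>\<^bsub>V\<^esub> v) = h \<odot>\<^bsub>W\<^esub> f v"
    and "f \<in> extensional (carrier V)"
  shows "f \<in> Hom V W"
  using assms by (auto simp: Hom_def hom_def)

lemma HomD:
  assumes "f \<in> Hom V W"
  shows "v \<in> carrier V \<Longrightarrow> f v \<in> carrier W"
    and "\<lbrakk>v \<in> carrier V; w \<in> carrier V\<rbrakk> \<Longrightarrow> f (v \<oplus>\<^bsub>V\<^esub> w) = f v \<oplus>\<^bsub>W\<^esub> f w"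
    and "v \<in> carrier V \<Longrightarrow> f (h \<odot>\<^bsub>V\<^esub> v) = h \<odot>\<^bsub>W\<^esub> f v"
    and "f \<in> extensional (carrier V)"
  using assms by (auto simp: Hom_def hom_def)

lemma Hom_restrictI:
  assumes "left_module V"
    and "\<And>v. v \<in> carrier V \<Longrightarrow> f v \<in> carrier W"
    and "\<And>v w. \<lbrakk>v \<in> carrier V; w \<in> carrier V\<rbrakk> \<Longrightarrow> f (v \<oplus>\<^bsub>V\<^esub> w) = f v \<oplus>\<^bsub>W\<^esub> f w"
    and "\<And>h v. v \<in> carrier V \<Longrightarrow> f (h \<odot>\<^bsub>V\<^esub> v) = h \<odot>\<^bsub>W\<^esub> f v"
  shows "restrict f (carrier V) \<in> Hom V W"
proof -
  interpret V: left_module V by fact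
  show ?thesis
    using assms(2-4) by (intro HomI) (auto simp: V.act_closed)
qed

lemma Hom_eqI:
  assumes "f \<in> Hom V W" "g \<in> Hom V W'" "\<And>v. v \<in> carrier V \<Longrightarrow> f v = g v"
  shows "f = g"
  using assms HomD(4) extensionalityI by metis

lemma Hom_zero:
  assumes "f \<in> Hom V W" "left_module V" "left_module W"
  shows "f \<zero>\<^bsub>V\<^esub> = \<zero>\<^bsub>W\<^esub>"
proof -
  interpret V: left_module V by fact
  interpret W: left_module W by fact
  show ?thesis
    using HomD(3)[OF assms(1) V.zero_closed, of 0] HomD(1)[OF assms(1) V.zero_closed]
    by (simp add: V.act_zero_right W.act_zero_left)
qed

lemma Hom_minus:
  assumes "f \<in> Hom V W" "left_module V" "left_module W" "v \<in> carrier V" "w \<in> carrier V"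
  shows "f (v \<ominus>\<^bsub>V\<^esub> w) = f v \<ominus>\<^bsub>W\<^esub> f w"
proof -
  interpret V: left_module V by fact
  interpret W: left_module W by fact
  have "f (\<ominus>\<^bsub>V\<^esub> w) = \<ominus>\<^bsub>W\<^esub> f w"
    using HomD(3)[OF assms(1,5), of "- 1"] HomD(1)[OF assms(1,5)] assms(5)
    by (simp add: V.act_minus_left W.act_minus_left V.act_one W.act_one)
  then show ?thesis
    using HomD(2)[OF assms(1,4)] assms(5) by (simp add: a_minus_def)
qed

lemma Hom_inj_onI:
  assumes "f \<in> Hom V W" "left_module V" "left_module W"
    and "\<And>v. \<lbrakk>v \<in> carrier V; f v = \<zero>\<^bsub>W\<^esub>\<rbrakk> \<Longrightarrow> v = \<zero>\<^bsub>V\<^esub>"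
  shows "inj_on f (carrier V)"
proof (rule inj_onI)
  interpret V: left_module V by fact
  interpret W: left_module W by fact
  fix x y assume x: "x \<in> carrier V" and y: "y \<in> carrier V" and "f x = f y"
  then have "f (x \<ominus>\<^bsub>V\<^esub> y) = \<zero>\<^bsub>W\<^esub>"
    using HomD(1)[OF assms(1)] by (simp add: Hom_minus[OF assms(1-3)] W.minus_eq_zero_iff)
  then show "x = y"
    using assms(4)[of "x \<ominus>\<^bsub>V\<^esub> y"] x y by (simp add: V.minus_eq_zero_iff)
qed

lemma Hom_finsum:
  assumes "f \<in> Hom V W" "left_module V" "left_module W"
    and "finite A" "\<And>i. i \<in> A \<Longrightarrow> v i \<in> carrier V"
  shows "f (\<Oplus>\<^bsub>V\<^esub>i\<in>A. v i) = (\<Oplus>\<^bsub>W\<^esub>i\<in>A. f (v i))"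
  using assms(4,5)
proof (induction A rule: finite_induct)
  interpret V: left_module V by fact
  interpret W: left_module W by fact
  case empty
  then show ?case by (simp add: Hom_zero[OF assms(1-3)])
next
  interpret V: left_module V by fact
  interpret W: left_module W by fact
  case (insert a A)
  then have "v \<in> A \<rightarrow> carrier V" "(\<lambda>i. f (v i)) \<in> A \<rightarrow> carrier W"
    using HomD(1)[OF assms(1)] by auto
  with insert show ?case
    using HomD(1,2)[OF assms(1)] by simp
qed

lemma inclusion_Hom:
  assumes "left_module V" "is_submodule U V"
  shows "(\<lambda>u\<in>U. u) \<in> Hom (V\<lparr>carrier := U\<rparr>) V"
proof -
  interpret V: left_module V by fact
  show ?thesis
    using V.is_submoduleD[OF assms(2)] by (intro HomI) auto
qed

lemma kernel_submodule:
  assumes "f \<in> Hom V W" "left_module V" "left_module W"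
  shows "is_submodule {v \<in> carrier V. f v = \<zero>\<^bsub>W\<^esub>} V"
proof -
  interpret V: left_module V by fact
  interpret W: left_module W by fact
  show ?thesis
    by (rule V.is_submoduleI)
      (auto simp: Hom_zero[OF assms] HomD(2,3)[OF assms(1)] V.act_closed W.act_zero_right)
qed

lemma image_submodule:
  assumes "f \<in> Hom V W" "left_module V" "left_module W"
  shows "is_submodule (f ` carrier V) W"
proof -
  interpret V: left_module V by fact
  interpret W: left_module W by fact
  show ?thesis
  proof (rule W.is_submoduleI)
    show "\<zero>\<^bsub>W\<^esub> \<in> f ` carrier V"
      using Hom_zero[OF assms] by (metis V.zero_closed imageI)
  next
    fix u w assume "u \<in> f ` carrier V" "w \<in> f ` carrier V"
    then obtain x y where "x \<in> carrier V" "y \<in> carrier V" "u = f x" "w = f y"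
      by blast
    then show "u \<oplus>\<^bsub>W\<^esub> w \<in> f ` carrier V"
      using HomD(2)[OF assms(1), of x y] by (metis V.a_closed imageI)
  next
    fix h u assume "u \<in> f ` carrier V"
    then obtain x where "x \<in> carrier V" "u = f x"
      by blast
    then show "h \<odot>\<^bsub>W\<^esub> u \<in> f ` carrier V"
      using HomD(3)[OF assms(1), of x h] by (metis V.act_closed imageI)
  qed (use HomD(1)[OF assms(1)] in auto)
qed

section \<open>Exactness in a full abelian subcategory closed under submodules\<close>

locale closed_subcategory = full_abelian_subcategory C
  for C :: "('h::{ring,monoid_mult}, 'v) module set" +
  assumes closed: "closed_under_submodules C"
begin

lemma submodule_object:
  assumes "V \<in> C" "is_submodule U V"
  shows "V\<lparr>carrier := U\<rparr> \<in> C"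
  using closed assms by (auto simp: closed_under_submodules_def)

text \<open>Closure under submodules provides two test objects. On the zero set of \<open>f\<close>
  the inclusion and the zero map have the same composite with \<open>f\<close>, so uniqueness
  equates them and \<open>f\<close> is injective. The inclusion of the zero set of \<open>g\<close>
  factors through \<open>f\<close>, so that set lies in the image of \<open>f\<close>.\<close>

lemma kernel_exact:
  assumes C: "V \<in> C" "W \<in> C" and g: "g \<in> Hom V W" and k: "is_kernel C V W g U f"
  shows "inj_on f (carrier U)" "f ` carrier U = {v \<in> carrier V. g v = \<zero>\<^bsub>W\<^esub>}"
proof -
  have U: "U \<in> C" and f: "f \<in> Hom U V" and gf: "compose (carrier U) g f = zero_mor U W"
    and univ: "\<And>T t. \<lbrakk>T \<in> C; t \<in> Hom T V; compose (carrier T) g t = zero_mor T W\<rbrakk> \<Longrightarrow>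
      \<exists>!u. u \<in> Hom T U \<and> compose (carrier T) f u = t"
    using k by (auto simp: is_kernel_def)
  interpret U: left_module U using objects[OF U] .
  interpret V: left_module V using objects[OF C(1)] .
  interpret W: left_module W using objects[OF C(2)] .
  let ?N = "{u \<in> carrier U. f u = \<zero>\<^bsub>V\<^esub>}"
  have N: "is_submodule ?N U"
    by (rule kernel_submodule) (use f U.left_module_axioms V.left_module_axioms in auto)
  have NC: "U\<lparr>carrier := ?N\<rparr> \<in> C"
    by (rule submodule_object[OF U N])
  have z: "(\<lambda>u\<in>?N. \<zero>\<^bsub>V\<^esub>) \<in> Hom (U\<lparr>carrier := ?N\<rparr>) V"
    using V.is_submodule_zero U.is_submoduleD[OF N] by (intro HomI) (auto simp: V.act_zero_right)
  have gz: "g \<zero>\<^bsub>V\<^esub> = \<zero>\<^bsub>W\<^esub>"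
    by (rule Hom_zero[OF g V.left_module_axioms W.left_module_axioms])
  have "\<exists>!u. u \<in> Hom (U\<lparr>carrier := ?N\<rparr>) U \<and> compose ?N f u = (\<lambda>u\<in>?N. \<zero>\<^bsub>V\<^esub>)"
    using univ[OF NC z] by (auto simp: compose_def zero_mor_def gz cong: restrict_cong)
  moreover have "(\<lambda>u\<in>?N. u) \<in> Hom (U\<lparr>carrier := ?N\<rparr>) U"
    by (rule inclusion_Hom[OF U.left_module_axioms N])
  moreover have "(\<lambda>u\<in>?N. \<zero>\<^bsub>U\<^esub>) \<in> Hom (U\<lparr>carrier := ?N\<rparr>) U"
    using U.is_submoduleD[OF N] by (intro HomI) (auto simp: U.act_zero_right)
  moreover have "compose ?N f (\<lambda>u\<in>?N. u) = (\<lambda>u\<in>?N. \<zero>\<^bsub>V\<^esub>)"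
    by (auto simp: compose_def fun_eq_iff)
  moreover have "compose ?N f (\<lambda>u\<in>?N. \<zero>\<^bsub>U\<^esub>) = (\<lambda>u\<in>?N. \<zero>\<^bsub>V\<^esub>)"
    using Hom_zero[OF f U.left_module_axioms V.left_module_axioms]
    by (auto simp: compose_def fun_eq_iff)
  ultimately have "(\<lambda>u\<in>?N. u) = (\<lambda>u\<in>?N. \<zero>\<^bsub>U\<^esub>)"
    by blast
  then have "u = \<zero>\<^bsub>U\<^esub>" if "u \<in> carrier U" "f u = \<zero>\<^bsub>V\<^esub>" for u
    using that by (metis (mono_tags, lifting) mem_Collect_eq restrict_apply')
  then show "inj_on f (carrier U)"
    by (intro Hom_inj_onI[OF f U.left_module_axioms V.left_module_axioms])
  let ?K = "{v \<in> carrier V. g v = \<zero>\<^bsub>W\<^esub>}"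
  have K: "is_submodule ?K V"
    by (rule kernel_submodule[OF g V.left_module_axioms W.left_module_axioms])
  have KC: "V\<lparr>carrier := ?K\<rparr> \<in> C"
    by (rule submodule_object[OF C(1) K])
  have "compose ?K g (\<lambda>v\<in>?K. v) = (\<lambda>v\<in>?K. \<zero>\<^bsub>W\<^esub>)"
    by (auto simp: compose_def fun_eq_iff)
  then obtain u where u: "u \<in> Hom (V\<lparr>carrier := ?K\<rparr>) U" "compose ?K f u = (\<lambda>v\<in>?K. v)"
    using univ[OF KC inclusion_Hom[OF V.left_module_axioms K]] by (auto simp: zero_mor_def)
  show "f ` carrier U = ?K"
  proof
    show "f ` carrier U \<subseteq> ?K"
      using gf HomD(1)[OF f] by (auto simp: compose_def zero_mor_def fun_eq_iff restrict_def) metis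
    show "?K \<subseteq> f ` carrier U"
    proof
      fix v assume v: "v \<in> ?K"
      then have "u v \<in> carrier U" "f (u v) = v"
        using HomD(1)[OF u(1), of v] fun_cong[OF u(2), of v] by (auto simp: compose_def)
      then show "v \<in> f ` carrier U" by (metis imageI)
    qed
  qed
qed

lemma inj_is_mono:
  assumes "f \<in> Hom V W" "inj_on f (carrier V)"
  shows "is_mono C V f"
  unfolding is_mono_def
proof (intro ballI impI)
  fix T g g'
  assume g: "g \<in> Hom T V" "g' \<in> Hom T V"
    and eq: "compose (carrier T) f g = compose (carrier T) f g'"
  show "g = g'"
  proof (rule Hom_eqI[OF g])
    fix t assume t: "t \<in> carrier T"
    then have "f (g t) = f (g' t)"
      using fun_cong[OF eq, of t] by (simp add: compose_def)
    then show "g t = g' t"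
      using assms(2) HomD(1)[OF g(1) t] HomD(1)[OF g(2) t] by (simp add: inj_on_eq_iff)
  qed
qed

text \<open>The inclusion of \<open>U\<close> is a monomorphism, hence normal, and its image is then
  the zero set of the morphism of which it is a kernel. This \<open>g\<close> stands in for the
  projection onto the quotient by \<open>U\<close>.\<close>

lemma submodule_is_kernel:
  assumes V: "V \<in> C" and U: "is_submodule U V"
  obtains T g where "T \<in> C" "g \<in> Hom V T" "U = {v \<in> carrier V. g v = \<zero>\<^bsub>T\<^esub>}"
proof -
  note i = inclusion_Hom[OF objects[OF V] U]
  note UC = submodule_object[OF V U]
  obtain T g where T: "T \<in> C" and g: "g \<in> Hom V T"
    and k: "is_kernel C V T g (V\<lparr>carrier := U\<rparr>) (\<lambda>u\<in>U. u)"
    using monos_normal[OF UC V i inj_is_mono[OF i]] by (auto simp: inj_on_def)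
  show thesis
    using that[OF T g] kernel_exact(2)[OF V T g k] by simp
qed

text \<open>The image of \<open>g\<close> is the zero set of some \<open>t\<close> on
  \<open>W\<close>. Both \<open>t\<close> and the zero morphism vanish after \<open>g\<close>, so
  uniqueness for the cokernel forces \<open>t\<close> to be zero and the image to be all of
  \<open>W\<close>.\<close>

lemma cokernel_surj:
  assumes C: "U \<in> C" "V \<in> C" and f: "f \<in> Hom U V" and q: "is_cokernel C U V f W g"
  shows "g ` carrier V = carrier W"
proof -
  have W: "W \<in> C" and g: "g \<in> Hom V W" and gf: "compose (carrier U) g f = zero_mor U W"
    and univ: "\<And>T t. \<lbrakk>T \<in> C; t \<in> Hom V T; compose (carrier U) t f = zero_mor U T\<rbrakk> \<Longrightarrow>
      \<exists>!u. u \<in> Hom W T \<and> compose (carrier V) u g = t"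
    using q by (auto simp: is_cokernel_def)
  note lV = objects[OF C(2)] and lW = objects[OF W]
  interpret V: left_module V using lV .
  interpret W: left_module W using lW .
  obtain T t where T: "T \<in> C" and t: "t \<in> Hom W T"
    and im: "g ` carrier V = {w \<in> carrier W. t w = \<zero>\<^bsub>T\<^esub>}"
    using submodule_is_kernel[OF W image_submodule[OF g lV lW]] by metis
  interpret T: left_module T using objects[OF T] .
  have z: "zero_mor V T \<in> Hom V T" "zero_mor W T \<in> Hom W T"
    unfolding zero_mor_def by (intro Hom_restrictI[OF lV] Hom_restrictI[OF lW];
        simp add: T.act_zero_right)+
  have "compose (carrier U) (zero_mor V T) f = zero_mor U T"
    using HomD(1)[OF f] by (auto simp: compose_def zero_mor_def fun_eq_iff)
  then have "\<exists>!u. u \<in> Hom W T \<and> compose (carrier V) u g = zero_mor V T"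
    using univ[OF T z(1)] by blast
  moreover have "compose (carrier V) t g = zero_mor V T"
    using im by (auto simp: compose_def zero_mor_def fun_eq_iff)
  moreover have "compose (carrier V) (zero_mor W T) g = zero_mor V T"
    using HomD(1)[OF g] by (auto simp: compose_def zero_mor_def fun_eq_iff)
  ultimately have "t = zero_mor W T"
    using t z(2) by blast
  then show ?thesis
    using im by (auto simp: zero_mor_def)
qed

lemma short_exactE:
  assumes "short_exact C U V W" "U \<in> C" "V \<in> C" "W \<in> C"
  obtains f g where "f \<in> Hom U V" "g \<in> Hom V W" "inj_on f (carrier U)"
    "f ` carrier U = {v \<in> carrier V. g v = \<zero>\<^bsub>W\<^esub>}" "g ` carrier V = carrier W"
proof -
  obtain f g where fg: "f \<in> Hom U V" "g \<in> Hom V W"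
      "is_kernel C V W g U f" "is_cokernel C U V f W g"
    using assms(1) by (auto simp: short_exact_def)
  show thesis
    using that[OF fg(1,2) kernel_exact[OF assms(3,4) fg(2,3)] cokernel_surj[OF assms(2,3) fg(1,4)]] .
qed

text \<open>Both universal properties are verified pointwise: a map into \<open>V\<close> lifts by
  inverting \<open>f\<close> on its image, and a map out of \<open>V\<close> descends by choosing
  preimages under \<open>g\<close>.\<close>

lemma short_exactI:
  assumes C: "U \<in> C" "V \<in> C" "W \<in> C"
    and f: "f \<in> Hom U V" and g: "g \<in> Hom V W" and inj: "inj_on f (carrier U)"
    and ex: "f ` carrier U = {v \<in> carrier V. g v = \<zero>\<^bsub>W\<^esub>}" and surj: "g ` carrier V = carrier W"
  shows "short_exact C U V W"
proof -
  note lU = objects[OF C(1)] and lV = objects[OF C(2)] and lW = objects[OF C(3)]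
  interpret U: left_module U using lU .
  interpret V: left_module V using lV .
  interpret W: left_module W using lW .
  have gf: "compose (carrier U) g f = zero_mor U W"
    using ex by (auto simp: compose_def zero_mor_def fun_eq_iff)
  have "is_kernel C V W g U f"
    unfolding is_kernel_def
  proof (intro conjI ballI impI C(1) f gf)
    fix T t assume T: "T \<in> C" and t: "t \<in> Hom T V"
      and gt: "compose (carrier T) g t = zero_mor T W"
    interpret T: left_module T using objects[OF T] .
    have "g (t x) = \<zero>\<^bsub>W\<^esub>" if "x \<in> carrier T" for x
      using fun_cong[OF gt, of x] that by (simp add: compose_def zero_mor_def)
    then have im: "t x \<in> f ` carrier U" if "x \<in> carrier T" for x
      using that HomD(1)[OF t that] unfolding ex by simp
    let ?u = "\<lambda>x. inv_into (carrier U) f (t x)"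
    have u: "?u x \<in> carrier U" "f (?u x) = t x" if "x \<in> carrier T" for x
      using im[OF that] by (auto simp: inv_into_into f_inv_into_f)
    have eqI: "x = y" if "f x = f y" "x \<in> carrier U" "y \<in> carrier U" for x y
      using inj that by (auto simp: inj_on_def)
    have "restrict ?u (carrier T) \<in> Hom T U"
    proof (rule Hom_restrictI[OF T.left_module_axioms])
      show "?u (v \<oplus>\<^bsub>T\<^esub> w) = ?u v \<oplus>\<^bsub>U\<^esub> ?u w" if "v \<in> carrier T" "w \<in> carrier T" for v w
        by (rule eqI) (use that u[OF T.a_closed[OF that]] in \<open>auto simp: u HomD(2)[OF f] HomD(2)[OF t]\<close>)
      show "?u (h \<odot>\<^bsub>T\<^esub> v) = h \<odot>\<^bsub>U\<^esub> ?u v" if "v \<in> carrier T" for h v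
        by (rule eqI) (use that u[OF T.act_closed[OF that, of h]] in
            \<open>auto simp: u HomD(3)[OF f] HomD(3)[OF t] T.act_closed U.act_closed\<close>)
    qed (use u in auto)
    moreover have "compose (carrier T) f (restrict ?u (carrier T)) = t"
      by (rule extensionalityI[OF compose_extensional HomD(4)[OF t]]) (simp add: compose_def u)
    moreover have "u1 = u2"
      if u1: "u1 \<in> Hom T U" "compose (carrier T) f u1 = t"
        and u2: "u2 \<in> Hom T U" "compose (carrier T) f u2 = t" for u1 u2
    proof (rule Hom_eqI[OF u1(1) u2(1)])
      fix x assume x: "x \<in> carrier T"
      have "f (u1 x) = f (u2 x)"
        using fun_cong[OF u1(2), of x] fun_cong[OF u2(2), of x] x by (simp add: compose_def)
      then show "u1 x = u2 x"
        using HomD(1)[OF u1(1) x] HomD(1)[OF u2(1) x] by (rule eqI)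
    qed
    ultimately show "\<exists>!u. u \<in> Hom T U \<and> compose (carrier T) f u = t"
      by blast
  qed
  moreover have "is_cokernel C U V f W g"
    unfolding is_cokernel_def
  proof (intro conjI ballI impI C(3) g gf)
    fix T t assume T: "T \<in> C" and t: "t \<in> Hom V T"
      and tf: "compose (carrier U) t f = zero_mor U T"
    note lT = objects[OF T]
    interpret T: left_module T using lT .
    have "t (f x) = \<zero>\<^bsub>T\<^esub>" if "x \<in> carrier U" for x
      using fun_cong[OF tf, of x] that by (simp add: compose_def zero_mor_def)
    then have ker: "t v = \<zero>\<^bsub>T\<^esub>" if "v \<in> carrier V" "g v = \<zero>\<^bsub>W\<^esub>" for v
      using that ex by (metis (mono_tags, lifting) image_iff mem_Collect_eq)
    have t_eqI: "t v = t w" if "g v = g w" "v \<in> carrier V" "w \<in> carrier V" for v w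
    proof -
      have "t (v \<ominus>\<^bsub>V\<^esub> w) = \<zero>\<^bsub>T\<^esub>"
        using that HomD(1)[OF g] by (intro ker) (auto simp: Hom_minus[OF g lV lW] W.minus_eq_zero_iff)
      then show ?thesis
        using that HomD(1)[OF t] by (simp add: Hom_minus[OF t lV lT] T.minus_eq_zero_iff)
    qed
    \<comment> \<open>A mere set-theoretic section of \<open>g\<close>. The map \<open>t\<close>
      identifies vectors with the same image under \<open>g\<close>, so \<open>t\<close> after
      \<open>?s\<close> does not see the choice and is a morphism.\<close>
    let ?s = "inv_into (carrier V) g"
    have s: "?s w \<in> carrier V" "g (?s w) = w" if "w \<in> carrier W" for w
      using surj that by (auto simp: inv_into_into f_inv_into_f)
    let ?u = "\<lambda>w. t (?s w)"
    have "restrict ?u (carrier W) \<in> Hom W T"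
    proof (rule Hom_restrictI[OF lW])
      show "?u (v \<oplus>\<^bsub>W\<^esub> w) = ?u v \<oplus>\<^bsub>T\<^esub> ?u w" if "v \<in> carrier W" "w \<in> carrier W" for v w
        using that
        by (subst HomD(2)[OF t, symmetric]) (auto intro!: t_eqI simp: s HomD(2)[OF g])
      show "?u (h \<odot>\<^bsub>W\<^esub> v) = h \<odot>\<^bsub>T\<^esub> ?u v" if "v \<in> carrier W" for h v
        using that by (subst HomD(3)[OF t, symmetric])
          (auto intro!: t_eqI simp: s HomD(3)[OF g] V.act_closed W.act_closed)
    qed (use s HomD(1)[OF t] in auto)
    moreover have "compose (carrier V) (restrict ?u (carrier W)) g = t"
      by (rule extensionalityI[OF compose_extensional HomD(4)[OF t]])
        (simp add: compose_def HomD(1)[OF g], rule t_eqI, auto simp: s HomD(1)[OF g])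
    moreover have "u1 = u2"
      if u1: "u1 \<in> Hom W T" "compose (carrier V) u1 g = t"
        and u2: "u2 \<in> Hom W T" "compose (carrier V) u2 g = t" for u1 u2
    proof (rule Hom_eqI[OF u1(1) u2(1)])
      fix w assume "w \<in> carrier W"
      then obtain v where "v \<in> carrier V" "w = g v"
        using surj by blast
      then show "u1 w = u2 w"
        using fun_cong[OF u1(2), of v] fun_cong[OF u2(2), of v] by (simp add: compose_def)
    qed
    ultimately show "\<exists>!u. u \<in> Hom W T \<and> compose (carrier V) u g = t"
      by blast
  qed
  ultimately show ?thesis
    using f g by (auto simp: short_exact_def)
qed

text \<open>By the first isomorphism theorem the image of \<open>g\<close> in \<open>T\<close> is a
  copy of the quotient, and it belongs to \<open>C\<close> as a submodule of \<open>T\<close>. The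
  last conclusion keeps the quotient by a proper submodule nonzero, which the induction on dimension
  needs.\<close>

lemma quotient_exists:
  assumes V: "V \<in> C" and U: "is_submodule U V"
  obtains W where "W \<in> C" "short_exact C (V\<lparr>carrier := U\<rparr>) V W"
    "carrier W = {\<zero>\<^bsub>W\<^esub>} \<Longrightarrow> U = carrier V"
proof -
  obtain T g where T: "T \<in> C" and g: "g \<in> Hom V T" and ker: "U = {v \<in> carrier V. g v = \<zero>\<^bsub>T\<^esub>}"
    using submodule_is_kernel[OF V U] .
  let ?W = "T\<lparr>carrier := g ` carrier V\<rparr>"
  have W: "?W \<in> C"
    by (rule submodule_object[OF T image_submodule[OF g objects[OF V] objects[OF T]]])
  moreover have "short_exact C (V\<lparr>carrier := U\<rparr>) V ?W"
  proof (rule short_exactI)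
    show "(\<lambda>u\<in>U. u) \<in> Hom (V\<lparr>carrier := U\<rparr>) V"
      by (rule inclusion_Hom[OF objects[OF V] U])
    show "g \<in> Hom V ?W"
      using g by (auto simp: Hom_def hom_def)
  qed (use V U W submodule_object ker in \<open>auto simp: inj_on_def\<close>)
  moreover have "U = carrier V" if "carrier ?W = {\<zero>\<^bsub>?W\<^esub>}"
    using that ker by auto
  ultimately show thesis
    using that by blast
qed

text \<open>The zero submodule of \<open>V\<close> serves as the zero object, so isomorphic objects
  get identified once zero modules are known to be relations.\<close>

lemma isomorphic_short_exact:
  assumes "U \<in> C" "V \<in> C" "isomorphic U V"
  shows "short_exact C U V (V\<lparr>carrier := {\<zero>\<^bsub>V\<^esub>}\<rparr>)"
proof -
  interpret V: left_module V using objects[OF assms(2)] .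
  obtain f where f: "f \<in> Hom U V" "bij_betw f (carrier U) (carrier V)"
    using assms(3) by (auto simp: isomorphic_def)
  show ?thesis
  proof (rule short_exactI[OF assms(1,2) _ f(1)])
    show "V\<lparr>carrier := {\<zero>\<^bsub>V\<^esub>}\<rparr> \<in> C"
      by (rule submodule_object[OF assms(2) V.is_submodule_zero])
    show "(\<lambda>v\<in>carrier V. \<zero>\<^bsub>V\<^esub>) \<in> Hom V (V\<lparr>carrier := {\<zero>\<^bsub>V\<^esub>}\<rparr>)"
      by (rule Hom_restrictI[OF V.left_module_axioms]) (auto simp: V.act_zero_right)
  qed (use f(2) in \<open>auto simp: bij_betw_def\<close>)
qed

text \<open>The associated relation is |V| - |V| - |V|, which makes |V| vanish.\<close>

lemma zero_module_short_exact:
  assumes "V \<in> C" "carrier V = {\<zero>\<^bsub>V\<^esub>}"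
  shows "short_exact C V V V"
proof -
  interpret V: left_module V using objects[OF assms(1)] .
  have z: "(\<lambda>v\<in>carrier V. \<zero>\<^bsub>V\<^esub>) \<in> Hom V V"
    by (rule Hom_restrictI[OF V.left_module_axioms]) (auto simp: V.act_zero_right)
  have V: "v \<in> carrier V \<longleftrightarrow> v = \<zero>\<^bsub>V\<^esub>" for v
    using assms(2) by blast
  show ?thesis
    by (rule short_exactI[OF assms(1) assms(1) assms(1) z z])
      (auto simp: V inj_on_def image_def)
qed

end

section \<open>Separating simple modules\<close>

definition left_ideal :: "'h::ring set \<Rightarrow> bool" where
  "left_ideal L \<longleftrightarrow> 0 \<in> L \<and> (\<forall>a\<in>L. \<forall>b\<in>L. a + b \<in> L) \<and> (\<forall>h. \<forall>a\<in>L. h * a \<in> L)"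

lemma left_ideal_diff:
  fixes L :: "'h::{ring,monoid_mult} set"
  assumes "left_ideal L" "a \<in> L" "b \<in> L"
  shows "a - b \<in> L"
proof -
  have "a + (- 1) * b \<in> L"
    using assms unfolding left_ideal_def by blast
  then show ?thesis by simp
qed

text \<open>Pairs are used so that vectors of several different modules can be annihilated
  simultaneously.\<close>

lemma left_ideal_annihilator:
  fixes T :: "(('h::{ring,monoid_mult}, 'v) module \<times> 'v) set"
  assumes "\<And>M x. (M, x) \<in> T \<Longrightarrow> left_module M \<and> x \<in> carrier M"
  shows "left_ideal {h. \<forall>(M, x)\<in>T. h \<odot>\<^bsub>M\<^esub> x = \<zero>\<^bsub>M\<^esub>}"
proof -
  have "0 \<odot>\<^bsub>M\<^esub> x = \<zero>\<^bsub>M\<^esub> \<and> (a \<odot>\<^bsub>M\<^esub> x = \<zero>\<^bsub>M\<^esub> \<longrightarrow> b \<odot>\<^bsub>M\<^esub> x = \<zero>\<^bsub>M\<^esub> \<longrightarrow> (a + b) \<odot>\<^bsub>M\<^esub> x = \<zero>\<^bsub>M\<^esub>) \<and>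
      (a \<odot>\<^bsub>M\<^esub> x = \<zero>\<^bsub>M\<^esub> \<longrightarrow> (h * a) \<odot>\<^bsub>M\<^esub> x = \<zero>\<^bsub>M\<^esub>)" if "(M, x) \<in> T" for M x h a b
  proof -
    interpret M: left_module M using assms that by blast
    have x: "x \<in> carrier M" using assms that by blast
    show ?thesis
      using x by (simp add: M.act_zero_left M.act_add_left M.act_mult M.act_zero_right)
  qed
  then show ?thesis
    unfolding left_ideal_def by fast
qed

lemma left_ideal_Int: "\<lbrakk>left_ideal K; left_ideal L\<rbrakk> \<Longrightarrow> left_ideal (K \<inter> L)"
  by (auto simp: left_ideal_def)

text \<open>The set \<open>L x\<close> is a submodule because \<open>L\<close> is a left ideal, and
  it is nonzero because it contains \<open>l x\<close>; simplicity leaves only the whole of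
  \<open>S\<close>.\<close>

lemma simple_module_orbit:
  assumes S: "simple_module S" and L: "left_ideal L" and x: "x \<in> carrier S"
    and l: "l \<in> L" "l \<odot>\<^bsub>S\<^esub> x \<noteq> \<zero>\<^bsub>S\<^esub>" and y: "y \<in> carrier S"
  obtains k where "k \<in> L" "k \<odot>\<^bsub>S\<^esub> x = y"
proof -
  interpret S: left_module S using S by (simp add: simple_module_def)
  let ?U = "(\<lambda>h. h \<odot>\<^bsub>S\<^esub> x) ` L"
  have "is_submodule ?U S"
  proof (rule S.is_submoduleI)
    show "\<zero>\<^bsub>S\<^esub> \<in> ?U"
      using L S.act_zero_left[OF x] by (force simp: left_ideal_def)
    show "u \<oplus>\<^bsub>S\<^esub> w \<in> ?U" if "u \<in> ?U" "w \<in> ?U" for u w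
      using that L S.act_add_left[OF x, symmetric] by (auto simp: left_ideal_def)
    show "h \<odot>\<^bsub>S\<^esub> u \<in> ?U" if "u \<in> ?U" for h u
      using that L S.act_mult[OF x, symmetric] by (auto simp: left_ideal_def)
  qed (use S.act_closed[OF x] in auto)
  then have "?U = carrier S"
    using S l by (auto simp: simple_module_def)
  then show thesis
    using y that by (metis imageE)
qed

text \<open>The isomorphism is \<open>l x \<mapsto> l v\<close>.\<close>

lemma isomorphic_if_annihilator_subset:
  assumes M: "simple_module M" and S: "simple_module S" and L: "left_ideal L"
    and x: "x \<in> carrier M" and v: "v \<in> carrier S"
    and k: "k \<in> L" "k \<odot>\<^bsub>M\<^esub> x \<noteq> \<zero>\<^bsub>M\<^esub>" and l: "l \<in> L" "l \<odot>\<^bsub>S\<^esub> v \<noteq> \<zero>\<^bsub>S\<^esub>"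
    and ann: "\<And>h. \<lbrakk>h \<in> L; h \<odot>\<^bsub>M\<^esub> x = \<zero>\<^bsub>M\<^esub>\<rbrakk> \<Longrightarrow> h \<odot>\<^bsub>S\<^esub> v = \<zero>\<^bsub>S\<^esub>"
  shows "isomorphic M S"
proof -
  have lM: "left_module M" and lS: "left_module S"
    using M S by (simp_all add: simple_module_def)
  interpret M: left_module M by fact
  interpret S: left_module S by fact
  have orb: "\<exists>h\<in>L. h \<odot>\<^bsub>M\<^esub> x = y" if "y \<in> carrier M" for y
    using simple_module_orbit[OF M L x k that] by blast
  \<comment> \<open>Any \<open>h\<close> in \<open>L\<close> with \<open>h x = y\<close> may be
    taken: two choices differ by an element of \<open>L\<close> killing \<open>x\<close>, which by
    \<open>ann\<close> kills \<open>v\<close> as well.\<close>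
  define F where "F = (\<lambda>y. (SOME h. h \<in> L \<and> h \<odot>\<^bsub>M\<^esub> x = y) \<odot>\<^bsub>S\<^esub> v)"
  have F: "F (h \<odot>\<^bsub>M\<^esub> x) = h \<odot>\<^bsub>S\<^esub> v" if "h \<in> L" for h
  proof -
    let ?h = "SOME h'. h' \<in> L \<and> h' \<odot>\<^bsub>M\<^esub> x = h \<odot>\<^bsub>M\<^esub> x"
    have h: "?h \<in> L \<and> ?h \<odot>\<^bsub>M\<^esub> x = h \<odot>\<^bsub>M\<^esub> x"
      by (rule someI[where x = h]) (use that in simp)
    then have "(?h - h) \<odot>\<^bsub>S\<^esub> v = \<zero>\<^bsub>S\<^esub>"
      using that left_ideal_diff[OF L] by (intro ann) (auto simp: M.act_diff_eq_zero_iff x)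
    then show ?thesis
      by (simp add: F_def S.act_diff_eq_zero_iff v)
  qed
  have Hom: "restrict F (carrier M) \<in> Hom M S"
  proof (rule Hom_restrictI[OF lM])
    show "F y \<in> carrier S" if "y \<in> carrier M" for y
      using orb[OF that] F S.act_closed[OF v] by auto
    show "F (y \<oplus>\<^bsub>M\<^esub> z) = F y \<oplus>\<^bsub>S\<^esub> F z" if "y \<in> carrier M" "z \<in> carrier M" for y z
    proof -
      obtain a b where ab: "a \<in> L" "b \<in> L" "y = a \<odot>\<^bsub>M\<^esub> x" "z = b \<odot>\<^bsub>M\<^esub> x"
        using orb \<open>y \<in> carrier M\<close> \<open>z \<in> carrier M\<close> by blast
      moreover have "a + b \<in> L"
        using L ab by (simp add: left_ideal_def)
      ultimately show ?thesis
        using F[of "a + b"] by (simp add: F M.act_add_left S.act_add_left x v)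
    qed
    show "F (h \<odot>\<^bsub>M\<^esub> y) = h \<odot>\<^bsub>S\<^esub> F y" if "y \<in> carrier M" for h y
    proof -
      obtain a where a: "a \<in> L" "y = a \<odot>\<^bsub>M\<^esub> x"
        using orb[OF \<open>y \<in> carrier M\<close>] by blast
      moreover have "h * a \<in> L"
        using L a by (simp add: left_ideal_def)
      ultimately show ?thesis
        using F[of "h * a"] by (simp add: F M.act_mult S.act_mult x v)
    qed
  qed
  have surj: "F ` carrier M = carrier S"
  proof
    show "carrier S \<subseteq> F ` carrier M"
    proof
      fix y assume "y \<in> carrier S"
      then obtain h where "h \<in> L" "h \<odot>\<^bsub>S\<^esub> v = y"
        using simple_module_orbit[OF S L v l] by blast
      then show "y \<in> F ` carrier M"
        using F[of h] M.act_closed[OF x] by (metis imageI)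
    qed
  qed (use HomD(1)[OF Hom] in auto)
  let ?K = "{y \<in> carrier M. restrict F (carrier M) y = \<zero>\<^bsub>S\<^esub>}"
  \<comment> \<open>The value of \<open>F\<close> at \<open>l x\<close> is \<open>l v\<close>, which
    is nonzero. So the kernel is proper and, \<open>M\<close> being simple, zero.\<close>
  have "l \<odot>\<^bsub>M\<^esub> x \<notin> ?K"
    using F[OF l(1)] l(2) M.act_closed[OF x, of l] by auto
  then have "?K \<noteq> carrier M"
    using M.act_closed[OF x, of l] by metis
  moreover have "is_submodule ?K M"
    by (rule kernel_submodule[OF Hom lM lS])
  ultimately have "?K = {\<zero>\<^bsub>M\<^esub>}"
    using M unfolding simple_module_def by blast
  then have "inj_on (restrict F (carrier M)) (carrier M)"
    by (intro Hom_inj_onI[OF Hom lM lS]) blast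
  with surj Hom show ?thesis
    unfolding isomorphic_def bij_betw_def by (intro bexI[OF _ Hom]) auto
qed

text \<open>Induction on \<open>T\<close>: the annihilator \<open>L\<close> of the earlier vectors
  moves \<open>v\<close>. If every element of \<open>L\<close> killing the new vector
  \<open>x\<close> also killed \<open>v\<close>, then \<open>l x\<close> would determine
  \<open>l v\<close> for \<open>l\<close> in \<open>L\<close>, and \<open>M\<close> would be
  isomorphic to \<open>S\<close>.\<close>

lemma ex_separating_vector:
  assumes S: "simple_module S" and v: "v \<in> carrier S" "v \<noteq> \<zero>\<^bsub>S\<^esub>"
    and "finite T"
    and "\<And>M x. (M, x) \<in> T \<Longrightarrow> simple_module M \<and> x \<in> carrier M \<and> \<not> isomorphic M S"
  shows "\<exists>h. (\<forall>(M, x)\<in>T. h \<odot>\<^bsub>M\<^esub> x = \<zero>\<^bsub>M\<^esub>) \<and> h \<odot>\<^bsub>S\<^esub> v \<noteq> \<zero>\<^bsub>S\<^esub>"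
  using assms(4,5)
proof (induction T rule: finite_induct)
  case empty
  interpret S: left_module S using S by (simp add: simple_module_def)
  show ?case
    using v by (auto intro!: exI[of _ 1] simp: S.act_one)
next
  case (insert p T)
  obtain M x where p: "p = (M, x)" by (cases p)
  then have M: "simple_module M" "x \<in> carrier M" "\<not> isomorphic M S"
    using insert.prems by auto
  let ?L = "{h. \<forall>(M, x)\<in>T. h \<odot>\<^bsub>M\<^esub> x = \<zero>\<^bsub>M\<^esub>}"
  have L: "left_ideal ?L"
    by (rule left_ideal_annihilator) (use insert.prems in \<open>auto simp: simple_module_def\<close>)
  obtain l where l: "l \<in> ?L" "l \<odot>\<^bsub>S\<^esub> v \<noteq> \<zero>\<^bsub>S\<^esub>"
    using insert.IH insert.prems by auto
  show ?case
  proof (rule ccontr)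
    assume "\<not> ?case"
    then have ann: "h \<odot>\<^bsub>S\<^esub> v = \<zero>\<^bsub>S\<^esub>" if "h \<in> ?L" "h \<odot>\<^bsub>M\<^esub> x = \<zero>\<^bsub>M\<^esub>" for h
      using that p by auto
    then have "l \<odot>\<^bsub>M\<^esub> x \<noteq> \<zero>\<^bsub>M\<^esub>"
      using l by blast
    then have "isomorphic M S"
      using isomorphic_if_annihilator_subset[OF M(1) S L M(2) v(1) l(1) _ l ann] by blast
    with M(3) show False ..
  qed
qed

text \<open>The quotient of the algebra by the annihilator of \<open>V\<close> embeds in a finite
  power of \<open>V\<close>. This is the trace of finite dimensionality that the separation argument
  uses, phrased without scalars.\<close>

definition finitely_annihilated :: "('h::{ring,monoid_mult}, 'v) module \<Rightarrow> bool" where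
  "finitely_annihilated V \<longleftrightarrow> (\<exists>X. finite X \<and> X \<subseteq> carrier V \<and>
     (\<forall>h. (\<forall>x\<in>X. h \<odot>\<^bsub>V\<^esub> x = \<zero>\<^bsub>V\<^esub>) \<longrightarrow> (\<forall>v\<in>carrier V. h \<odot>\<^bsub>V\<^esub> v = \<zero>\<^bsub>V\<^esub>)))"

text \<open>
  The common annihilator \<open>I\<close> of \<open>\<T>\<close> acts nontrivially on \<open>S\<close>.  For a minimal set \<open>X\<close> detecting the
  action of \<open>I\<close> on \<open>S\<close>, each \<open>x \<in> X\<close> is moved by an element of \<open>I\<close> which kills \<open>X - {x}\<close>, hence, by
  simplicity, fixed by one.  The sum \<open>e\<close> of these fixes \<open>X\<close>, so that \<open>b e\<close> and \<open>b\<close> agree on \<open>S\<close> for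
  every \<open>b \<in> I\<close>; as no nonzero vector of \<open>S\<close> is killed by \<open>I\<close>, \<open>e\<close> is the identity on \<open>S\<close>.
\<close>

lemma ex_separating_element:
  assumes S: "simple_module S" "finitely_annihilated S" and "finite \<T>"
    and \<T>: "\<And>M. M \<in> \<T> \<Longrightarrow> simple_module M \<and> finitely_annihilated M \<and> \<not> isomorphic M S"
  shows "\<exists>e. (\<forall>v\<in>carrier S. e \<odot>\<^bsub>S\<^esub> v = v) \<and> (\<forall>M\<in>\<T>. \<forall>v\<in>carrier M. e \<odot>\<^bsub>M\<^esub> v = \<zero>\<^bsub>M\<^esub>)"
proof -
  interpret S: left_module S using S by (simp add: simple_module_def)
  have mod: "left_module M" if "M \<in> \<T>" for M
    using \<T>[OF that] by (simp add: simple_module_def)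
  define I where "I = {h. \<forall>(M, x)\<in>Sigma \<T> carrier. h \<odot>\<^bsub>M\<^esub> x = \<zero>\<^bsub>M\<^esub>}"
  have I: "left_ideal I"
    unfolding I_def by (rule left_ideal_annihilator) (use mod in auto)
  \<comment> \<open>Since \<open>I\<close> annihilates whole modules and not just selected vectors,
    it is a two-sided ideal.\<close>
  have I_right: "b * h \<in> I" if "b \<in> I" for b h
    unfolding I_def
  proof clarify
    fix M x assume M: "M \<in> \<T>" and x: "x \<in> carrier M"
    interpret M: left_module M using mod[OF M] .
    show "(b * h) \<odot>\<^bsub>M\<^esub> x = \<zero>\<^bsub>M\<^esub>"
      using that M x unfolding I_def by (auto simp: M.act_mult M.act_closed)
  qed
  obtain X where X: "\<And>M. M \<in> \<T> \<Longrightarrow> finite (X M) \<and> X M \<subseteq> carrier M \<and>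
     (\<forall>h. (\<forall>x\<in>X M. h \<odot>\<^bsub>M\<^esub> x = \<zero>\<^bsub>M\<^esub>) \<longrightarrow> (\<forall>v\<in>carrier M. h \<odot>\<^bsub>M\<^esub> v = \<zero>\<^bsub>M\<^esub>))"
    using \<T> unfolding finitely_annihilated_def by metis
  have I_detect: "\<exists>b\<in>I. b \<odot>\<^bsub>S\<^esub> v \<noteq> \<zero>\<^bsub>S\<^esub>" if v: "v \<in> carrier S" "v \<noteq> \<zero>\<^bsub>S\<^esub>" for v
  proof -
    \<comment> \<open>Vectors can be separated from finitely many others only; killing the finite
      sets \<open>X M\<close> is enough to lie in \<open>I\<close>.\<close>
    have "\<exists>h. (\<forall>(M, x)\<in>Sigma \<T> X. h \<odot>\<^bsub>M\<^esub> x = \<zero>\<^bsub>M\<^esub>) \<and> h \<odot>\<^bsub>S\<^esub> v \<noteq> \<zero>\<^bsub>S\<^esub>"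
      by (rule ex_separating_vector[OF S(1) v]) (use \<T> X \<open>finite \<T>\<close> in \<open>auto intro!: finite_SigmaI\<close>)
    then obtain h where h: "\<And>M x. \<lbrakk>M \<in> \<T>; x \<in> X M\<rbrakk> \<Longrightarrow> h \<odot>\<^bsub>M\<^esub> x = \<zero>\<^bsub>M\<^esub>" "h \<odot>\<^bsub>S\<^esub> v \<noteq> \<zero>\<^bsub>S\<^esub>"
      by blast
    then have "h \<in> I"
      using X unfolding I_def by blast
    with h show ?thesis by blast
  qed
  define P where "P Y \<longleftrightarrow> finite Y \<and> Y \<subseteq> carrier S \<and>
    (\<forall>h\<in>I. (\<forall>x\<in>Y. h \<odot>\<^bsub>S\<^esub> x = \<zero>\<^bsub>S\<^esub>) \<longrightarrow> (\<forall>v\<in>carrier S. h \<odot>\<^bsub>S\<^esub> v = \<zero>\<^bsub>S\<^esub>))" for Y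
  have "\<exists>Y. P Y"
    using S(2) unfolding finitely_annihilated_def P_def by blast
  then obtain Y where Y: "P Y" and min: "\<And>Z. P Z \<Longrightarrow> card Y \<le> card Z"
    using ex_has_least_nat[of P _ card] by metis
  have Y': "finite Y" "Y \<subseteq> carrier S"
    using Y by (auto simp: P_def)
  have kill: "h \<odot>\<^bsub>S\<^esub> v = \<zero>\<^bsub>S\<^esub>" if "h \<in> I" "\<And>x. x \<in> Y \<Longrightarrow> h \<odot>\<^bsub>S\<^esub> x = \<zero>\<^bsub>S\<^esub>" "v \<in> carrier S" for h v
    using Y that unfolding P_def by blast
  have fix_one: "\<exists>e\<in>I. e \<odot>\<^bsub>S\<^esub> x = x \<and> (\<forall>y\<in>Y - {x}. e \<odot>\<^bsub>S\<^esub> y = \<zero>\<^bsub>S\<^esub>)" if x: "x \<in> Y" for x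
  proof -
    let ?L = "I \<inter> {h. \<forall>(M, y)\<in>{S} \<times> (Y - {x}). h \<odot>\<^bsub>M\<^esub> y = \<zero>\<^bsub>M\<^esub>}"
    have L: "left_ideal ?L"
      by (rule left_ideal_Int[OF I left_ideal_annihilator])
        (use Y' S.left_module_axioms in auto)
    \<comment> \<open>Without \<open>x\<close> the set no longer detects the action of
      \<open>I\<close>. A witness \<open>h\<close> kills the other elements of \<open>Y\<close> but
      moves some vector, so it cannot kill \<open>x\<close> too.\<close>
    have "\<not> P (Y - {x})"
      using min[of "Y - {x}"] card_Diff1_less[OF Y'(1) x] by linarith
    then obtain h v where h: "h \<in> I" "\<forall>y\<in>Y - {x}. h \<odot>\<^bsub>S\<^esub> y = \<zero>\<^bsub>S\<^esub>"
      and v: "v \<in> carrier S" "h \<odot>\<^bsub>S\<^esub> v \<noteq> \<zero>\<^bsub>S\<^esub>"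
      using Y' unfolding P_def by blast
    then have "h \<odot>\<^bsub>S\<^esub> x \<noteq> \<zero>\<^bsub>S\<^esub>"
      using kill[OF h(1) _ v(1)] by blast
    moreover have "h \<in> ?L"
      using h by auto
    ultimately have h: "h \<in> ?L" "h \<odot>\<^bsub>S\<^esub> x \<noteq> \<zero>\<^bsub>S\<^esub>"
      by simp_all
    have xS: "x \<in> carrier S"
      using x Y' by blast
    obtain e where e: "e \<in> ?L" "e \<odot>\<^bsub>S\<^esub> x = x"
      by (rule simple_module_orbit[OF S(1) L xS h xS])
    then show ?thesis
      by (intro bexI[of _ e]) simp_all
  qed
  \<comment> \<open>The clause on \<open>Y - Z\<close> carries the induction: \<open>e\<close> kills
    the new \<open>x\<close> and \<open>d\<close> kills \<open>Z\<close>, so in \<open>e + d\<close>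
    the two actions do not interfere.\<close>
  have "\<exists>e\<in>I. (\<forall>x\<in>Z. e \<odot>\<^bsub>S\<^esub> x = x) \<and> (\<forall>y\<in>Y - Z. e \<odot>\<^bsub>S\<^esub> y = \<zero>\<^bsub>S\<^esub>)" if "finite Z" "Z \<subseteq> Y" for Z
    using that
  proof (induction Z rule: finite_induct)
    case empty
    show ?case
      using I Y' by (intro bexI[of _ 0]) (auto simp: left_ideal_def S.act_zero_left)
  next
    case (insert x Z)
    then obtain e where e: "e \<in> I" "\<forall>x\<in>Z. e \<odot>\<^bsub>S\<^esub> x = x" "\<forall>y\<in>Y - Z. e \<odot>\<^bsub>S\<^esub> y = \<zero>\<^bsub>S\<^esub>"
      by auto
    obtain d where d: "d \<in> I" "d \<odot>\<^bsub>S\<^esub> x = x" "\<forall>y\<in>Y - {x}. d \<odot>\<^bsub>S\<^esub> y = \<zero>\<^bsub>S\<^esub>"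
      using fix_one insert.prems by blast
    have "e + d \<in> I"
      using I e(1) d(1) by (simp add: left_ideal_def)
    moreover have "(e + d) \<odot>\<^bsub>S\<^esub> y = e \<odot>\<^bsub>S\<^esub> y \<oplus>\<^bsub>S\<^esub> d \<odot>\<^bsub>S\<^esub> y" "y \<in> carrier S" if "y \<in> Y" for y
      using that Y' by (auto simp: S.act_add_left)
    moreover have "d \<odot>\<^bsub>S\<^esub> y = \<zero>\<^bsub>S\<^esub>" if "y \<in> Z" for y
      using that d(3) insert.hyps insert.prems by blast
    ultimately show ?case
      using e d insert.hyps insert.prems
      by (intro bexI[of _ "e + d"]) (auto simp: subset_iff)
  qed
  from this[OF Y'(1)] obtain e where e: "e \<in> I" "\<And>x. x \<in> Y \<Longrightarrow> e \<odot>\<^bsub>S\<^esub> x = x"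
    by auto
  have "e \<odot>\<^bsub>S\<^esub> v = v" if v: "v \<in> carrier S" for v
  proof (rule ccontr)
    assume "e \<odot>\<^bsub>S\<^esub> v \<noteq> v"
    then have "(e - 1) \<odot>\<^bsub>S\<^esub> v \<noteq> \<zero>\<^bsub>S\<^esub>"
      by (simp add: S.act_diff_eq_zero_iff S.act_one v)
    then obtain b where b: "b \<in> I" "b \<odot>\<^bsub>S\<^esub> ((e - 1) \<odot>\<^bsub>S\<^esub> v) \<noteq> \<zero>\<^bsub>S\<^esub>"
      using I_detect S.act_closed[OF v] by blast
    \<comment> \<open>The factor \<open>b\<close> brings \<open>e - 1\<close> into \<open>I\<close>,
      as required by \<open>kill\<close>.\<close>
    have "(b * (e - 1)) \<odot>\<^bsub>S\<^esub> v = \<zero>\<^bsub>S\<^esub>"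
    proof (rule kill[OF I_right[OF b(1)] _ v])
      fix x assume "x \<in> Y"
      then have "x \<in> carrier S" "(e - 1) \<odot>\<^bsub>S\<^esub> x = \<zero>\<^bsub>S\<^esub>"
        using Y' e(2) by (auto simp: S.act_diff_eq_zero_iff S.act_one)
      then show "(b * (e - 1)) \<odot>\<^bsub>S\<^esub> x = \<zero>\<^bsub>S\<^esub>"
        by (simp add: S.act_mult S.act_zero_right)
    qed
    with b(2) show False
      by (simp add: S.act_mult v)
  qed
  with e(1) show ?thesis
    unfolding I_def by blast
qed

section \<open>Traces\<close>

lemma (in abelian_monoid) finsum_Plus:
  assumes "finite A" "finite B"
    and "\<And>i. i \<in> A \<Longrightarrow> f (Inl i) \<in> carrier G"
    and "\<And>j. j \<in> B \<Longrightarrow> f (Inr j) \<in> carrier G"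
  shows "(\<Oplus>k\<in>A <+> B. f k) = (\<Oplus>i\<in>A. f (Inl i)) \<oplus> (\<Oplus>j\<in>B. f (Inr j))"
proof -
  have "(\<Oplus>k\<in>A <+> B. f k) = (\<Oplus>k\<in>Inl ` A. f k) \<oplus> (\<Oplus>k\<in>Inr ` B. f k)"
    unfolding Plus_def using assms by (intro finsum_Un_disjoint) auto
  also have "(\<Oplus>k\<in>Inl ` A. f k) = (\<Oplus>i\<in>A. f (Inl i))"
    using assms by (intro finsum_reindex) (auto simp: inj_on_def)
  also have "(\<Oplus>k\<in>Inr ` B. f k) = (\<Oplus>j\<in>B. f (Inr j))"
    using assms by (intro finsum_reindex) (auto simp: inj_on_def)
  finally show ?thesis .
qed

context assoc_algebra
begin

section \<open>The vector space structure induced on a module\<close>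

lemma act_scale:
  assumes "left_module V" "v \<in> carrier V"
  shows "scale c h \<odot>\<^bsub>V\<^esub> v = scal V c (h \<odot>\<^bsub>V\<^esub> v)"
proof -
  interpret V: left_module V by fact
  have "scale c h = scale c 1 * h"
    by (simp add: scale_mult_left)
  then show ?thesis
    using assms(2) by (simp add: scal_def V.act_mult)
qed

text \<open>The elements \<open>scale c 1\<close> are central, so the algebra acts by linear
  maps.\<close>

lemma act_scal:
  assumes "left_module V" "v \<in> carrier V"
  shows "h \<odot>\<^bsub>V\<^esub> scal V c v = scal V c (h \<odot>\<^bsub>V\<^esub> v)"
proof -
  interpret V: left_module V by fact
  have "h * scale c 1 = scale c h"
    by (simp add: scale_mult_right)
  then show ?thesis
    using assms by (metis V.act_mult act_scale scal_def)
qed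

lemma scal_closed: "\<lbrakk>left_module V; v \<in> carrier V\<rbrakk> \<Longrightarrow> scal V c v \<in> carrier V"
  by (simp add: scal_def left_module.act_closed)

lemma scal_add_left:
  "\<lbrakk>left_module V; v \<in> carrier V\<rbrakk> \<Longrightarrow> scal V (c + d) v = scal V c v \<oplus>\<^bsub>V\<^esub> scal V d v"
  by (simp add: scal_def scale_left_distrib left_module.act_add_left)

lemma scal_add_right:
  "\<lbrakk>left_module V; v \<in> carrier V; w \<in> carrier V\<rbrakk> \<Longrightarrow>
    scal V c (v \<oplus>\<^bsub>V\<^esub> w) = scal V c v \<oplus>\<^bsub>V\<^esub> scal V c w"
  by (simp add: scal_def left_module.act_add_right)

lemma scal_mult:
  assumes "left_module V" "v \<in> carrier V"
  shows "scal V (c * d) v = scal V c (scal V d v)"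
  using act_scale[OF assms, of c "scale d 1"] by (simp add: scal_def)

lemma scal_one: "\<lbrakk>left_module V; v \<in> carrier V\<rbrakk> \<Longrightarrow> scal V 1 v = v"
  by (simp add: scal_def left_module.act_one)

lemma scal_zero_left: "\<lbrakk>left_module V; v \<in> carrier V\<rbrakk> \<Longrightarrow> scal V 0 v = \<zero>\<^bsub>V\<^esub>"
  by (simp add: scal_def left_module.act_zero_left)

lemma scal_zero_right: "left_module V \<Longrightarrow> scal V c \<zero>\<^bsub>V\<^esub> = \<zero>\<^bsub>V\<^esub>"
  by (simp add: scal_def left_module.act_zero_right)

lemma Hom_scal: "\<lbrakk>f \<in> Hom V W; v \<in> carrier V\<rbrakk> \<Longrightarrow> f (scal V c v) = scal W c (f v)"
  by (simp add: scal_def HomD(3))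

lemma finsum_scal_add:
  assumes "left_module V" "\<And>i. i \<in> A \<Longrightarrow> v i \<in> carrier V"
  shows "(\<Oplus>\<^bsub>V\<^esub>i\<in>A. scal V (c i + d i) (v i)) =
    (\<Oplus>\<^bsub>V\<^esub>i\<in>A. scal V (c i) (v i)) \<oplus>\<^bsub>V\<^esub> (\<Oplus>\<^bsub>V\<^esub>i\<in>A. scal V (d i) (v i))"
proof -
  interpret V: left_module V by fact
  have "(\<Oplus>\<^bsub>V\<^esub>i\<in>A. scal V (c i + d i) (v i)) =
    (\<Oplus>\<^bsub>V\<^esub>i\<in>A. scal V (c i) (v i) \<oplus>\<^bsub>V\<^esub> scal V (d i) (v i))"
    using assms by (intro V.finsum_cong') (auto simp: scal_add_left scal_closed)
  also have "\<dots> = (\<Oplus>\<^bsub>V\<^esub>i\<in>A. scal V (c i) (v i)) \<oplus>\<^bsub>V\<^esub> (\<Oplus>\<^bsub>V\<^esub>i\<in>A. scal V (d i) (v i))"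
    using assms by (intro V.finsum_addf) (auto simp: scal_closed)
  finally show ?thesis .
qed

lemma scal_finsum:
  assumes "left_module V" "finite A" "\<And>i. i \<in> A \<Longrightarrow> v i \<in> carrier V"
  shows "scal V e (\<Oplus>\<^bsub>V\<^esub>i\<in>A. scal V (c i) (v i)) = (\<Oplus>\<^bsub>V\<^esub>i\<in>A. scal V (e * c i) (v i))"
proof -
  interpret V: left_module V by fact
  have "scal V e (\<Oplus>\<^bsub>V\<^esub>i\<in>A. scal V (c i) (v i)) = (\<Oplus>\<^bsub>V\<^esub>i\<in>A. scal V e (scal V (c i) (v i)))"
    unfolding scal_def[of V e] using assms by (intro V.act_finsum) (auto simp: scal_closed)
  also have "\<dots> = (\<Oplus>\<^bsub>V\<^esub>i\<in>A. scal V (e * c i) (v i))"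
    using assms by (intro V.finsum_cong') (auto simp: scal_closed scal_mult)
  finally show ?thesis .
qed

section \<open>Linear functionals and dual families\<close>

lemma dual_spaceD:
  assumes "f \<in> dual_space V"
  shows "\<lbrakk>v \<in> carrier V; w \<in> carrier V\<rbrakk> \<Longrightarrow> f (v \<oplus>\<^bsub>V\<^esub> w) = f v + f w"
    and "v \<in> carrier V \<Longrightarrow> f (scal V c v) = c * f v"
  using assms by (auto simp: dual_space_def)

lemma dual_space_zero:
  assumes "f \<in> dual_space V" "left_module V"
  shows "f \<zero>\<^bsub>V\<^esub> = 0"
proof -
  interpret V: left_module V by fact
  show ?thesis
    using dual_spaceD(2)[OF assms(1) V.zero_closed, of 0] assms(2) by (simp add: scal_zero_right)
qed

lemma dual_space_finsum:
  assumes "f \<in> dual_space V" "left_module V" "finite A" "\<And>i. i \<in> A \<Longrightarrow> v i \<in> carrier V"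
  shows "f (\<Oplus>\<^bsub>V\<^esub>i\<in>A. scal V (c i) (v i)) = (\<Sum>i\<in>A. c i * f (v i))"
  using assms(3,4)
proof (induction A rule: finite_induct)
  interpret V: left_module V by fact
  case empty
  then show ?case by (simp add: dual_space_zero[OF assms(1,2)])
next
  interpret V: left_module V by fact
  case (insert a A)
  then have *: "(\<lambda>i. scal V (c i) (v i)) \<in> A \<rightarrow> carrier V" "scal V (c a) (v a) \<in> carrier V"
    using scal_closed[OF assms(2)] by auto
  with insert show ?case
    by (simp add: dual_spaceD[OF assms(1)])
qed

text \<open>Index sets of arbitrary type let the families of two modules be joined along a disjoint sum.\<close>

definition dual_family ::
  "('h, 'v) module \<Rightarrow> 'i set \<Rightarrow> ('i \<Rightarrow> 'v) \<Rightarrow> ('i \<Rightarrow> 'v \<Rightarrow> 'k) \<Rightarrow> bool" where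
  "dual_family V A v f \<longleftrightarrow> finite A \<and> (\<forall>i\<in>A. v i \<in> carrier V \<and> f i \<in> dual_space V) \<and>
     (\<forall>x\<in>carrier V. (\<Oplus>\<^bsub>V\<^esub>i\<in>A. scal V (f i x) (v i)) = x)"

lemma represents_unit_iff:
  "represents_unit V t \<longleftrightarrow> dual_family V {..<length t} (\<lambda>i. fst (t ! i)) (\<lambda>i. snd (t ! i))"
proof -
  have "set t \<subseteq> carrier V \<times> dual_space V \<longleftrightarrow>
    (\<forall>i<length t. fst (t ! i) \<in> carrier V \<and> snd (t ! i) \<in> dual_space V)"
    unfolding subset_eq all_set_conv_all_nth mem_Times_iff ..
  then show ?thesis
    unfolding represents_unit_def dual_family_def by auto
qed

lemma beta_eq_sum: "beta V t h = (\<Sum>i<length t. snd (t ! i) (h \<odot>\<^bsub>V\<^esub> fst (t ! i)))"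
  unfolding beta_def matrix_coeff_def
  by (simp add: sum_list_sum_nth case_prod_beta atLeast0LessThan)

lemma dual_family_represents_unit:
  assumes V: "left_module V" and f: "dual_family V A v f"
  shows "\<exists>t. represents_unit V t"
proof -
  interpret V: left_module V by fact
  have A: "finite A" using f by (simp add: dual_family_def)
  obtain xs where xs: "set xs = A" "distinct xs"
    using finite_distinct_list[OF A] by blast
  let ?t = "map (\<lambda>i. (v i, f i)) xs"
  have im: "(!) xs ` {..<length xs} = A" "inj_on ((!) xs) {..<length xs}"
    using xs by (auto simp: set_conv_nth inj_on_nth)
  have "(\<Oplus>\<^bsub>V\<^esub>i\<in>{..<length xs}. scal V (f (xs ! i) x) (v (xs ! i))) = x" if "x \<in> carrier V" for x
  proof -
    have "(\<lambda>i. scal V (f i x) (v i)) \<in> (!) xs ` {..<length xs} \<rightarrow> carrier V"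
      using f V im(1) by (auto simp: dual_family_def scal_closed)
    from V.finsum_reindex[OF this im(2)] show ?thesis
      using f that im(1) by (simp add: dual_family_def)
  qed
  moreover have "(\<Oplus>\<^bsub>V\<^esub>i\<in>{..<length xs}. scal V (snd (?t ! i) x) (fst (?t ! i))) =
    (\<Oplus>\<^bsub>V\<^esub>i\<in>{..<length xs}. scal V (f (xs ! i) x) (v (xs ! i)))" if "x \<in> carrier V" for x
    using f V xs by (intro V.finsum_cong') (auto simp: dual_family_def scal_closed)
  moreover have "set ?t \<subseteq> carrier V \<times> dual_space V"
    using f xs by (auto simp: dual_family_def)
  ultimately have "represents_unit V ?t"
    by (simp add: represents_unit_def)
  then show ?thesis ..
qed

text \<open>Expanding each \<open>v i\<close> in the second family turns the left side into a double
  sum of \<open>g j (v i) * f i (h w j)\<close>. Summing over \<open>i\<close> first recovers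
  \<open>h w j\<close> from the first family. Linear independence plays no part in this.\<close>

lemma dual_family_trace_unique:
  assumes V: "left_module V" and f: "dual_family V A v f" and g: "dual_family V B w g"
  shows "(\<Sum>i\<in>A. f i (h \<odot>\<^bsub>V\<^esub> v i)) = (\<Sum>j\<in>B. g j (h \<odot>\<^bsub>V\<^esub> w j))"
proof -
  interpret V: left_module V by fact
  have f': "finite A" "\<And>i. i \<in> A \<Longrightarrow> v i \<in> carrier V" "\<And>i. i \<in> A \<Longrightarrow> f i \<in> dual_space V"
      "\<And>x. x \<in> carrier V \<Longrightarrow> (\<Oplus>\<^bsub>V\<^esub>i\<in>A. scal V (f i x) (v i)) = x"
    using f by (auto simp: dual_family_def)
  have g': "finite B" "\<And>j. j \<in> B \<Longrightarrow> w j \<in> carrier V" "\<And>j. j \<in> B \<Longrightarrow> g j \<in> dual_space V"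
      "\<And>x. x \<in> carrier V \<Longrightarrow> (\<Oplus>\<^bsub>V\<^esub>j\<in>B. scal V (g j x) (w j)) = x"
    using g by (auto simp: dual_family_def)
  have "f i (h \<odot>\<^bsub>V\<^esub> v i) = (\<Sum>j\<in>B. g j (v i) * f i (h \<odot>\<^bsub>V\<^esub> w j))" if "i \<in> A" for i
  proof -
    have "h \<odot>\<^bsub>V\<^esub> v i = h \<odot>\<^bsub>V\<^esub> (\<Oplus>\<^bsub>V\<^esub>j\<in>B. scal V (g j (v i)) (w j))"
      using f'(2)[OF that] g'(4) by simp
    also have "\<dots> = (\<Oplus>\<^bsub>V\<^esub>j\<in>B. h \<odot>\<^bsub>V\<^esub> scal V (g j (v i)) (w j))"
      using g' V by (intro V.act_finsum) (auto simp: scal_closed)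
    also have "\<dots> = (\<Oplus>\<^bsub>V\<^esub>j\<in>B. scal V (g j (v i)) (h \<odot>\<^bsub>V\<^esub> w j))"
      using g' V by (intro V.finsum_cong') (auto simp: scal_closed act_scal V.act_closed)
    finally show ?thesis
      using dual_space_finsum[OF f'(3)[OF that] V g'(1), of "\<lambda>j. h \<odot>\<^bsub>V\<^esub> w j"] g'(2)
      by (simp add: V.act_closed)
  qed
  then have "(\<Sum>i\<in>A. f i (h \<odot>\<^bsub>V\<^esub> v i)) = (\<Sum>i\<in>A. \<Sum>j\<in>B. g j (v i) * f i (h \<odot>\<^bsub>V\<^esub> w j))"
    by simp
  also have "\<dots> = (\<Sum>j\<in>B. \<Sum>i\<in>A. f i (h \<odot>\<^bsub>V\<^esub> w j) * g j (v i))"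
    by (subst sum.swap) (simp add: mult.commute)
  also have "\<dots> = (\<Sum>j\<in>B. g j (\<Oplus>\<^bsub>V\<^esub>i\<in>A. scal V (f i (h \<odot>\<^bsub>V\<^esub> w j)) (v i)))"
    using dual_space_finsum[OF g'(3) V f'(1,2)] by simp
  also have "\<dots> = (\<Sum>j\<in>B. g j (h \<odot>\<^bsub>V\<^esub> w j))"
    using f'(4) g'(2) V.act_closed by simp
  finally show ?thesis .
qed

lemma z_elem_eq:
  assumes V: "left_module V" and f: "dual_family V A v f"
  shows "z_elem V h = (\<Sum>i\<in>A. f i (h \<odot>\<^bsub>V\<^esub> v i))"
proof -
  have "represents_unit V (SOME t. represents_unit V t)"
    by (rule someI_ex[OF dual_family_represents_unit[OF assms]])
  then show ?thesis
    unfolding z_elem_def beta_eq_sum represents_unit_iff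
    by (rule dual_family_trace_unique[OF V _ f])
qed

text \<open>A spanning set of least cardinality is a basis, and the functionals are its coordinates.
  The normalisation \<open>f b b = 1\<close> is recorded so that the trace of the identity counts
  the basis.\<close>

lemma ex_dual_basis:
  assumes V: "left_module V" and fd: "finite_dimensional V"
  obtains B f where "dual_family V B (\<lambda>b. b) f" "\<And>b. b \<in> B \<Longrightarrow> f b b = 1"
proof -
  interpret V: left_module V by fact
  let ?L = "\<lambda>B c. \<Oplus>\<^bsub>V\<^esub>b\<in>B. scal V (c b) b"
  define P where "P B \<longleftrightarrow> finite B \<and> B \<subseteq> carrier V \<and> (\<forall>v\<in>carrier V. \<exists>c. v = ?L B c)" for B
  have ex: "\<exists>B. P B"
    using fd by (simp add: finite_dimensional_def P_def)
  obtain B where B: "P B" and min: "\<And>B'. P B' \<Longrightarrow> card B \<le> card B'"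
    using ex_has_least_nat[of P _ card] ex by metis
  have fin: "finite B" and BV: "\<And>b. b \<in> B \<Longrightarrow> b \<in> carrier V"
    using B by (auto simp: P_def)
  have L_closed: "?L B c \<in> carrier V" for c
    using BV V by (intro V.finsum_closed) (auto simp: scal_closed)
  have indep: "k a = 0" if k: "?L B k = \<zero>\<^bsub>V\<^esub>" and a: "a \<in> B" for k a
  proof (rule ccontr)
    assume ka: "k a \<noteq> 0"
    have "P (B - {a})"
      unfolding P_def
    proof (intro conjI ballI)
      fix v assume "v \<in> carrier V"
      then obtain c where c: "v = ?L B c"
        using B by (auto simp: P_def)
      \<comment> \<open>The multiple of the relation \<open>k\<close> is chosen to make the
        coefficient at \<open>a\<close> vanish.\<close>
      define d where "d b = c b + (- (c a / k a)) * k b" for b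
      have "?L B d = ?L B c \<oplus>\<^bsub>V\<^esub> scal V (- (c a / k a)) (?L B k)"
        unfolding d_def using V fin BV by (simp only: finsum_scal_add scal_finsum)
      also have "\<dots> = v"
        unfolding k using \<open>v \<in> carrier V\<close> V c by (simp add: scal_zero_right)
      finally have "v = ?L (insert a (B - {a})) d"
        using a by (simp add: insert_absorb)
      also have "\<dots> = scal V (d a) a \<oplus>\<^bsub>V\<^esub> ?L (B - {a}) d"
        using fin BV a V by (intro V.finsum_insert) (auto simp: scal_closed)
      also have "\<dots> = ?L (B - {a}) d"
        using ka BV a V by (simp add: d_def scal_zero_left scal_closed Pi_iff)
      finally show "\<exists>c. v = ?L (B - {a}) c"
        by (rule exI[of _ d])
    qed (use fin BV in auto)
    then show False
      using min[of "B - {a}"] card_Diff1_less[OF fin a] by simp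
  qed
  have unique: "c b = d b" if "?L B c = ?L B d" "b \<in> B" for c d b
  proof -
    have "?L B (\<lambda>b. c b + (- 1) * d b) = ?L B c \<oplus>\<^bsub>V\<^esub> scal V (- 1) (?L B d)"
      using V fin BV by (simp only: finsum_scal_add scal_finsum)
    also have "\<dots> = scal V (1 + (- 1)) (?L B d)"
      unfolding that(1) scal_add_left[OF V L_closed] scal_one[OF V L_closed] ..
    also have "\<dots> = \<zero>\<^bsub>V\<^esub>"
      using V L_closed by (simp add: scal_zero_left)
    finally show ?thesis
      using indep[of "\<lambda>b. c b + (- 1) * d b" b] that(2) by simp
  qed
  obtain k where k: "\<And>v. v \<in> carrier V \<Longrightarrow> ?L B (k v) = v"
    using B unfolding P_def by metis
  \<comment> \<open>The coordinates \<open>k v\<close> come from an arbitrary choice, but their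
    uniqueness makes them linear in \<open>v\<close>.\<close>
  define f where "f b v = k v b" for b v
  have "f b \<in> dual_space V" if b: "b \<in> B" for b
    unfolding dual_space_def f_def
  proof (intro CollectI conjI ballI allI)
    fix v w assume "v \<in> carrier V" "w \<in> carrier V"
    then have "?L B (k (v \<oplus>\<^bsub>V\<^esub> w)) = ?L B (\<lambda>b. k v b + k w b)"
      using finsum_scal_add[OF V, of B "\<lambda>b. b" "k v" "k w"] BV by (simp add: k)
    then show "k (v \<oplus>\<^bsub>V\<^esub> w) b = k v b + k w b"
      by (rule unique[OF _ b])
  next
    fix c v assume v: "v \<in> carrier V"
    then have "?L B (k (scal V c v)) = ?L B (\<lambda>b. c * k v b)"
      using scal_finsum[OF V fin, of "\<lambda>b. b" c "k v"] BV by (simp add: k scal_closed[OF V])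
    then show "k (scal V c v) b = c * k v b"
      by (rule unique[OF _ b])
  qed
  moreover have "f b b = 1" if b: "b \<in> B" for b
  proof -
    have "?L B (\<lambda>a. if a = b then 1 else 0) = (\<Oplus>\<^bsub>V\<^esub>a\<in>B. if a = b then a else \<zero>\<^bsub>V\<^esub>)"
      using BV V by (intro V.finsum_cong') (auto simp: scal_one scal_zero_left)
    also have "\<dots> = b"
      using BV b fin by (intro V.add.finprod_singleton_swap) auto
    finally have "?L B (k b) = ?L B (\<lambda>a. if a = b then 1 else 0)"
      using k BV b by simp
    from unique[OF this b] show ?thesis
      by (simp add: f_def)
  qed
  ultimately show thesis
    using that[of B f] fin BV k by (simp add: dual_family_def f_def)
qed

lemma finite_dimensional_finitely_annihilated:
  assumes V: "left_module V" and fd: "finite_dimensional V"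
  shows "finitely_annihilated V"
proof -
  interpret V: left_module V by fact
  obtain B where B: "finite B" "B \<subseteq> carrier V"
      "\<And>v. v \<in> carrier V \<Longrightarrow> \<exists>c. v = (\<Oplus>\<^bsub>V\<^esub>b\<in>B. scal V (c b) b)"
    using fd unfolding finite_dimensional_def by blast
  have "h \<odot>\<^bsub>V\<^esub> v = \<zero>\<^bsub>V\<^esub>" if h: "\<forall>x\<in>B. h \<odot>\<^bsub>V\<^esub> x = \<zero>\<^bsub>V\<^esub>" and v: "v \<in> carrier V" for h v
  proof -
    obtain c where "v = (\<Oplus>\<^bsub>V\<^esub>b\<in>B. scal V (c b) b)"
      using B(3)[OF v] by blast
    then have "h \<odot>\<^bsub>V\<^esub> v = (\<Oplus>\<^bsub>V\<^esub>b\<in>B. h \<odot>\<^bsub>V\<^esub> scal V (c b) b)"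
      using B V by (auto intro!: V.act_finsum scal_closed)
    also have "\<dots> = (\<Oplus>\<^bsub>V\<^esub>b\<in>B. \<zero>\<^bsub>V\<^esub>)"
      using B V h by (intro V.finsum_cong') (auto simp: act_scal subset_iff scal_zero_right)
    finally show ?thesis by simp
  qed
  then show ?thesis
    unfolding finitely_annihilated_def using B(1,2) by (intro exI[of _ B]) simp
qed

lemma z_elem_in_dual_group:
  assumes V: "left_module V" and fd: "finite_dimensional V"
  shows "z_elem V \<in> carrier dual_group"
proof -
  interpret V: left_module V by fact
  obtain B f where f: "dual_family V B (\<lambda>b. b) f"
    using ex_dual_basis[OF assms] by metis
  then have B: "\<And>b. b \<in> B \<Longrightarrow> b \<in> carrier V" "\<And>b. b \<in> B \<Longrightarrow> f b \<in> dual_space V"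
    by (auto simp: dual_family_def)
  have "Vector_Spaces.linear scale (*) (z_elem V)"
    unfolding Vector_Spaces.linear_iff
  proof (intro conjI allI)
    show "vector_space scale" "vector_space ((*) :: 'k \<Rightarrow> 'k \<Rightarrow> 'k)"
      by unfold_locales (auto simp: algebra_simps)
    show "z_elem V (g + h) = z_elem V g + z_elem V h" for g h
      unfolding z_elem_eq[OF V f] using B
      by (simp add: V.act_add_left dual_spaceD(1) V.act_closed sum.distrib)
    show "z_elem V (scale c h) = c * z_elem V h" for c h
      unfolding z_elem_eq[OF V f] using B V
      by (simp add: act_scale dual_spaceD(2) V.act_closed sum_distrib_left)
  qed
  then show ?thesis
    by (simp add: dual_group_def)
qed

text \<open>Here \<open>n\<close> is the size of a basis. The equivalence concerns the natural
  number itself, because its image in the field may vanish for a nonzero module in positive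
  characteristic.\<close>

lemma z_elem_one:
  assumes V: "left_module V" and fd: "finite_dimensional V"
  obtains n where "z_elem V 1 = of_nat n" "n = 0 \<longleftrightarrow> carrier V = {\<zero>\<^bsub>V\<^esub>}"
proof -
  interpret V: left_module V by fact
  obtain B f where f: "dual_family V B (\<lambda>b. b) f" and one: "\<And>b. b \<in> B \<Longrightarrow> f b b = 1"
    using ex_dual_basis[OF assms] by blast
  then have B: "finite B" "\<And>b. b \<in> B \<Longrightarrow> b \<in> carrier V" "\<And>b. b \<in> B \<Longrightarrow> f b \<in> dual_space V"
      "\<And>x. x \<in> carrier V \<Longrightarrow> (\<Oplus>\<^bsub>V\<^esub>b\<in>B. scal V (f b x) b) = x"
    by (auto simp: dual_family_def)
  have "z_elem V 1 = of_nat (card B)"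
    unfolding z_elem_eq[OF V f] using B(2) one by (simp add: V.act_one)
  moreover have "card B = 0 \<longleftrightarrow> carrier V = {\<zero>\<^bsub>V\<^esub>}"
  proof
    assume "card B = 0"
    then have "B = {}" using B(1) by simp
    then show "carrier V = {\<zero>\<^bsub>V\<^esub>}"
      using B(4) by auto
  next
    assume *: "carrier V = {\<zero>\<^bsub>V\<^esub>}"
    have "B = {}"
    proof (rule equals0I)
      fix b assume b: "b \<in> B"
      then have "b = \<zero>\<^bsub>V\<^esub>"
        using B(2) * by blast
      then show False
        using one[OF b] dual_space_zero[OF B(3)[OF b] V] by simp
    qed
    then show "card B = 0" by simp
  qed
  ultimately show thesis
    by (rule that)
qed

lemma z_elem_cong:
  assumes V: "left_module V" and fd: "finite_dimensional V"
    and "\<And>v. v \<in> carrier V \<Longrightarrow> g \<odot>\<^bsub>V\<^esub> v = h \<odot>\<^bsub>V\<^esub> v"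
  shows "z_elem V g = z_elem V h"
proof -
  obtain B f where f: "dual_family V B (\<lambda>b. b) f"
    using ex_dual_basis[OF V fd] by metis
  then show ?thesis
    unfolding z_elem_eq[OF V f] using assms(3) by (simp add: dual_family_def)
qed

lemma z_elem_eq_0:
  assumes V: "left_module V" and fd: "finite_dimensional V"
    and "\<And>v. v \<in> carrier V \<Longrightarrow> h \<odot>\<^bsub>V\<^esub> v = \<zero>\<^bsub>V\<^esub>"
  shows "z_elem V h = 0"
proof -
  obtain B f where f: "dual_family V B (\<lambda>b. b) f"
    using ex_dual_basis[OF V fd] by metis
  then show ?thesis
    unfolding z_elem_eq[OF V f] using assms(3) V by (simp add: dual_family_def dual_space_zero)
qed

text \<open>
  A dual family of \<open>V\<close> is obtained from those of \<open>U\<close> and \<open>W\<close> by means of a linear section \<open>s\<close> of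
  \<open>g\<close> and the corresponding projection \<open>p\<close> of \<open>V\<close> onto \<open>U\<close>.
\<close>

lemma z_elem_exact:
  assumes U: "left_module U" "finite_dimensional U" and W: "left_module W" "finite_dimensional W"
    and V: "left_module V" and f: "f \<in> Hom U V" and g: "g \<in> Hom V W"
    and inj: "inj_on f (carrier U)" and ex: "f ` carrier U = {v \<in> carrier V. g v = \<zero>\<^bsub>W\<^esub>}"
    and surj: "g ` carrier V = carrier W"
  shows "z_elem V h = z_elem U h + z_elem W h"
proof -
  interpret U: left_module U by fact
  interpret V: left_module V by fact
  interpret W: left_module W by fact
  obtain A \<phi> where \<phi>: "dual_family U A (\<lambda>b. b) \<phi>"
    using ex_dual_basis[OF U] by metis
  then have A: "finite A" "\<And>b. b \<in> A \<Longrightarrow> b \<in> carrier U" "\<And>b. b \<in> A \<Longrightarrow> \<phi> b \<in> dual_space U"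
      "\<And>x. x \<in> carrier U \<Longrightarrow> (\<Oplus>\<^bsub>U\<^esub>b\<in>A. scal U (\<phi> b x) b) = x"
    by (auto simp: dual_family_def)
  obtain B \<psi> where \<psi>: "dual_family W B (\<lambda>b. b) \<psi>"
    using ex_dual_basis[OF W] by metis
  then have B: "finite B" "\<And>b. b \<in> B \<Longrightarrow> b \<in> carrier W" "\<And>b. b \<in> B \<Longrightarrow> \<psi> b \<in> dual_space W"
      "\<And>x. x \<in> carrier W \<Longrightarrow> (\<Oplus>\<^bsub>W\<^esub>b\<in>B. scal W (\<psi> b x) b) = x"
    by (auto simp: dual_family_def)
  define r where "r = inv_into (carrier V) g"
  have r: "r w \<in> carrier V \<and> g (r w) = w" if "w \<in> carrier W" for w
    using that surj by (simp add: r_def inv_into_into f_inv_into_f)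
  \<comment> \<open>The lifts \<open>r\<close> are used on the basis only and extended by the
    coordinates \<open>\<psi>\<close>. The resulting section is linear over the field, though in
    general not over the algebra.\<close>
  define s where "s w = (\<Oplus>\<^bsub>V\<^esub>b\<in>B. scal V (\<psi> b w) (r b))" for w
  have s_closed: "s w \<in> carrier V" for w
    unfolding s_def using B r V by (auto intro!: V.finsum_closed scal_closed)
  have s_add: "s (v \<oplus>\<^bsub>W\<^esub> w) = s v \<oplus>\<^bsub>V\<^esub> s w" if "v \<in> carrier W" "w \<in> carrier W" for v w
  proof -
    have "s (v \<oplus>\<^bsub>W\<^esub> w) = (\<Oplus>\<^bsub>V\<^esub>b\<in>B. scal V (\<psi> b v + \<psi> b w) (r b))"
      unfolding s_def using B r V that
      by (intro V.finsum_cong') (auto simp: dual_spaceD(1) intro!: scal_closed)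
    then show ?thesis
      using B r by (simp add: s_def finsum_scal_add[OF V])
  qed
  have s_scal: "s (scal W c w) = scal V c (s w)" if "w \<in> carrier W" for c w
  proof -
    have "s (scal W c w) = (\<Oplus>\<^bsub>V\<^esub>b\<in>B. scal V (c * \<psi> b w) (r b))"
      unfolding s_def using B r V that
      by (intro V.finsum_cong') (auto simp: dual_spaceD(2) intro!: scal_closed)
    then show ?thesis
      using B r by (simp add: s_def scal_finsum[OF V])
  qed
  have s_zero: "s \<zero>\<^bsub>W\<^esub> = \<zero>\<^bsub>V\<^esub>"
    using s_scal[of "\<zero>\<^bsub>W\<^esub>" 0] s_closed V W by (simp add: scal_zero_right scal_zero_left)
  have gs: "g (s w) = w" if "w \<in> carrier W" for w
  proof -
    have "g (s w) = (\<Oplus>\<^bsub>W\<^esub>b\<in>B. g (scal V (\<psi> b w) (r b)))"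
      unfolding s_def using B r V by (intro Hom_finsum[OF g V W(1)]) (auto intro!: scal_closed)
    also have "\<dots> = (\<Oplus>\<^bsub>W\<^esub>b\<in>B. scal W (\<psi> b w) b)"
      using B r W by (intro W.finsum_cong') (auto simp: Hom_scal[OF g] intro!: scal_closed)
    finally show ?thesis
      using B(4)[OF that] by simp
  qed
  \<comment> \<open>The component of \<open>x\<close> in the kernel of \<open>g\<close>, that is, in
    the image of \<open>f\<close>; pulling it back along \<open>f\<close> yields the projection
    \<open>p\<close>.\<close>
  define q where "q x = x \<ominus>\<^bsub>V\<^esub> s (g x)" for x
  have q: "q x \<in> f ` carrier U" if "x \<in> carrier V" for x
    unfolding ex q_def using that s_closed gs HomD(1)[OF g]
    by (simp add: Hom_minus[OF g V W(1)] W.minus_eq_zero_iff)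
  define p where "p x = inv_into (carrier U) f (q x)" for x
  have p: "p x \<in> carrier U \<and> f (p x) = q x" if "x \<in> carrier V" for x
    using q[OF that] by (simp add: p_def inv_into_into f_inv_into_f)
  have f_eqD: "x = y" if "f x = f y" "x \<in> carrier U" "y \<in> carrier U" for x y
    using inj that by (auto simp: inj_on_def)
  have p_add: "p (x \<oplus>\<^bsub>V\<^esub> y) = p x \<oplus>\<^bsub>U\<^esub> p y" if "x \<in> carrier V" "y \<in> carrier V" for x y
  proof (rule f_eqD)
    have "q (x \<oplus>\<^bsub>V\<^esub> y) = q x \<oplus>\<^bsub>V\<^esub> q y"
      using that s_closed HomD(1)[OF g] unfolding q_def a_minus_def
      by (simp add: HomD(2)[OF g] s_add V.minus_add V.a_ac)
    then show "f (p (x \<oplus>\<^bsub>V\<^esub> y)) = f (p x \<oplus>\<^bsub>U\<^esub> p y)"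
      using p[OF V.a_closed[OF that]] p[OF that(1)] p[OF that(2)] by (simp add: HomD(2)[OF f])
  qed (use that p in auto)
  have p_scal: "p (scal V c x) = scal U c (p x)" if "x \<in> carrier V" for c x
  proof (rule f_eqD)
    have "q (scal V c x) = scal V c (q x)"
    proof -
      have "scal V c (\<ominus>\<^bsub>V\<^esub> v) = \<ominus>\<^bsub>V\<^esub> scal V c v" if "v \<in> carrier V" for v
        using act_scal[OF V that, of "- 1" c] that scal_closed[OF V]
        by (simp add: V.act_minus_left V.act_one)
      then show ?thesis
        using that s_closed HomD(1)[OF g] unfolding q_def a_minus_def
        by (simp add: Hom_scal[OF g] s_scal scal_add_right[OF V])
    qed
    then show "f (p (scal V c x)) = f (scal U c (p x))"
      using p[OF scal_closed[OF V that]] p[OF that] by (simp add: Hom_scal[OF f])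
  qed (use that p in \<open>simp_all add: scal_closed[OF U(1)] scal_closed[OF V]\<close>)
  have pf: "p (f u) = u" if u: "u \<in> carrier U" for u
  proof (rule f_eqD)
    have fu: "f u \<in> carrier V" "g (f u) = \<zero>\<^bsub>W\<^esub>"
      using u ex by auto
    then show "f (p (f u)) = f u"
      using p[OF fu(1)] by (simp add: q_def s_zero a_minus_def)
  qed (use u p HomD(1)[OF f] in auto)
  let ?v = "case_sum f r"
  \<comment> \<open>With these functionals the expansion of \<open>x\<close> reads
    \<open>f (p x)\<close> plus \<open>s (g x)\<close>.\<close>
  let ?F = "case_sum (\<lambda>a x. \<phi> a (p x)) (\<lambda>b x. \<psi> b (g x))"
  have "dual_family V (A <+> B) ?v ?F"
    unfolding dual_family_def
  proof (intro conjI ballI)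
    fix i assume "i \<in> A <+> B"
    then show "?v i \<in> carrier V" "?F i \<in> dual_space V"
      using A B r p HomD(1,2)[OF f] HomD(1,2)[OF g]
      by (auto simp: dual_space_def p_add p_scal Hom_scal[OF g] split: sum.split)
  next
    fix x assume x: "x \<in> carrier V"
    have "(\<Oplus>\<^bsub>V\<^esub>i\<in>A <+> B. scal V (?F i x) (?v i)) =
        (\<Oplus>\<^bsub>V\<^esub>a\<in>A. scal V (\<phi> a (p x)) (f a)) \<oplus>\<^bsub>V\<^esub> (\<Oplus>\<^bsub>V\<^esub>b\<in>B. scal V (\<psi> b (g x)) (r b))"
      using A B r HomD(1)[OF f] by (subst V.finsum_Plus) (auto intro!: scal_closed[OF V])
    also have "(\<Oplus>\<^bsub>V\<^esub>a\<in>A. scal V (\<phi> a (p x)) (f a)) = (\<Oplus>\<^bsub>V\<^esub>a\<in>A. f (scal U (\<phi> a (p x)) a))"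
      using A HomD(1)[OF f] U V
      by (intro V.finsum_cong') (auto simp: Hom_scal[OF f] intro!: scal_closed)
    also have "\<dots> = f (\<Oplus>\<^bsub>U\<^esub>a\<in>A. scal U (\<phi> a (p x)) a)"
      using A U by (intro Hom_finsum[OF f U(1) V, symmetric]) (auto intro!: scal_closed)
    also have "\<dots> = q x"
      using A(4) p[OF x] by simp
    also have "q x \<oplus>\<^bsub>V\<^esub> (\<Oplus>\<^bsub>V\<^esub>b\<in>B. scal V (\<psi> b (g x)) (r b)) = x"
      using x s_closed[of "g x"]
      by (simp add: q_def s_def[symmetric] a_minus_def V.a_assoc V.l_neg)
    finally show "(\<Oplus>\<^bsub>V\<^esub>i\<in>A <+> B. scal V (?F i x) (?v i)) = x" .
  qed (use A B in simp)
  from z_elem_eq[OF V this, of h]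
  have "z_elem V h = (\<Sum>a\<in>A. \<phi> a (p (h \<odot>\<^bsub>V\<^esub> f a))) + (\<Sum>b\<in>B. \<psi> b (g (h \<odot>\<^bsub>V\<^esub> r b)))"
    using A(1) B(1) by (simp add: sum.Plus)
  \<comment> \<open>The action of \<open>h\<close> is block triangular: \<open>p\<close> undoes
    \<open>f\<close> on the submodule and \<open>g\<close> commutes with \<open>h\<close> on the
    quotient. The failure of \<open>s\<close> to be a module morphism only affects the off-diagonal
    block.\<close>
  also have "(\<Sum>a\<in>A. \<phi> a (p (h \<odot>\<^bsub>V\<^esub> f a))) = (\<Sum>a\<in>A. \<phi> a (h \<odot>\<^bsub>U\<^esub> a))"
    using A(2) by (intro sum.cong) (auto simp: HomD(3)[OF f, symmetric] pf U.act_closed)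
  also have "(\<Sum>b\<in>B. \<psi> b (g (h \<odot>\<^bsub>V\<^esub> r b))) = (\<Sum>b\<in>B. \<psi> b (h \<odot>\<^bsub>W\<^esub> b))"
    using B(2) r by (intro sum.cong) (auto simp: HomD(3)[OF g])
  finally show ?thesis
    by (simp add: z_elem_eq[OF U(1) \<phi>] z_elem_eq[OF W(1) \<psi>])
qed

end

section \<open>The trace map on the Grothendieck group\<close>

locale finite_dimensional_subcategory = assoc_algebra scale + closed_subcategory C
  for scale :: "'k::field \<Rightarrow> 'h::{ring,monoid_mult} \<Rightarrow> 'h" and C :: "('h, 'v) module set" +
  assumes fd: "V \<in> C \<Longrightarrow> finite_dimensional V"
begin

abbreviation F where "F \<equiv> free_Abelian_group C"
abbreviation R where "R \<equiv> K0_relations C"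

section \<open>The subgroup of relations\<close>

lemma K0_generator:
  "\<lbrakk>U \<in> C; V \<in> C; W \<in> C; short_exact C U V W\<rbrakk> \<Longrightarrow> frag_of V - frag_of U - frag_of W \<in> R"
  unfolding K0_relations_def by (rule generate.incl) blast

lemma subgroup_relations: "subgroup R F"
  unfolding K0_relations_def
proof (rule group.generate_is_subgroup[OF group_free_Abelian_group], clarify)
  fix U V W assume C: "U \<in> C" "V \<in> C" "W \<in> C"
  have "Poly_Mapping.keys (frag_of V - frag_of U - frag_of W) \<subseteq> {V} \<union> {U} \<union> {W}"
    using keys_diff[of "frag_of V - frag_of U" "frag_of W"] keys_diff[of "frag_of V" "frag_of U"]
    by auto
  with C show "frag_of V - frag_of U - frag_of W \<in> carrier F"
    by auto
qed

lemma
  shows relations_zero: "0 \<in> R"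
    and relations_add: "\<lbrakk>a \<in> R; b \<in> R\<rbrakk> \<Longrightarrow> a + b \<in> R"
    and relations_cmul: "a \<in> R \<Longrightarrow> frag_cmul k a \<in> R"
    and relations_diff: "\<lbrakk>a \<in> R; b \<in> R\<rbrakk> \<Longrightarrow> a - b \<in> R"
proof -
  interpret R: subgroup R F by (rule subgroup_relations)
  show "0 \<in> R" using R.one_closed by simp
  show add: "\<And>a b. \<lbrakk>a \<in> R; b \<in> R\<rbrakk> \<Longrightarrow> a + b \<in> R" using R.m_closed by simp
  show cmul: "\<And>a k. a \<in> R \<Longrightarrow> frag_cmul k a \<in> R"
  proof -
    fix a k assume a: "a \<in> R"
    then have "Poly_Mapping.keys a \<subseteq> C"
      using subsetD[OF R.subset a] by simp
    then show "frag_cmul k a \<in> R"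
      using group.subgroup_int_pow_closed[OF group_free_Abelian_group subgroup_relations a, of k]
      by simp
  qed
  show "\<lbrakk>a \<in> R; b \<in> R\<rbrakk> \<Longrightarrow> a - b \<in> R"
    using add[of a "- b"] cmul[of b "- 1"] by simp
qed

lemma zero_module_relation:
  assumes "V \<in> C" "carrier V = {\<zero>\<^bsub>V\<^esub>}"
  shows "frag_of V \<in> R"
proof -
  have "- frag_of V \<in> R"
    using K0_generator[OF assms(1) assms(1) assms(1) zero_module_short_exact[OF assms]] by simp
  then show ?thesis
    using relations_diff[OF relations_zero] by fastforce
qed

lemma isomorphic_relation:
  assumes "U \<in> C" "V \<in> C" "isomorphic U V"
  shows "frag_of V - frag_of U \<in> R"
proof -
  interpret V: left_module V using objects[OF assms(2)] .
  let ?Z = "V\<lparr>carrier := {\<zero>\<^bsub>V\<^esub>}\<rparr>"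
  have Z: "?Z \<in> C"
    by (rule submodule_object[OF assms(2) V.is_submodule_zero])
  have "frag_of V - frag_of U - frag_of ?Z \<in> R"
    by (rule K0_generator[OF assms(1,2) Z isomorphic_short_exact[OF assms]])
  moreover have "frag_of ?Z \<in> R"
    using zero_module_relation[OF Z] by simp
  ultimately show ?thesis
    using relations_add by fastforce
qed

text \<open>The additive extension of \<open>z_elem\<close> to formal combinations of objects; the
  isomorphism of the theorem is the map it induces on cosets of \<open>R\<close>.\<close>

definition trace_map :: "(('h, 'v) module \<Rightarrow>\<^sub>0 int) \<Rightarrow> 'h \<Rightarrow> 'k" where
  "trace_map c h = (\<Sum>V\<in>Poly_Mapping.keys c. of_int (Poly_Mapping.lookup c V) * z_elem V h)"

lemma trace_map_superset:
  assumes "finite A" "Poly_Mapping.keys c \<subseteq> A"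
  shows "trace_map c h = (\<Sum>V\<in>A. of_int (Poly_Mapping.lookup c V) * z_elem V h)"
  unfolding trace_map_def using assms by (intro sum.mono_neutral_left) (auto simp: in_keys_iff)

lemma trace_map_zero: "trace_map 0 h = 0"
  by (simp add: trace_map_def)

lemma trace_map_frag_of: "trace_map (frag_of V) = z_elem V"
  by (rule ext) (simp add: trace_map_def)

lemma trace_map_add: "trace_map (c + d) h = trace_map c h + trace_map d h"
proof -
  let ?A = "Poly_Mapping.keys c \<union> Poly_Mapping.keys d"
  have "Poly_Mapping.keys (c + d) \<subseteq> ?A"
    by (rule Poly_Mapping.keys_add)
  then show ?thesis
    using trace_map_superset[of ?A] by (simp add: lookup_add distrib_right sum.distrib)
qed

lemma trace_map_diff: "trace_map (c - d) h = trace_map c h - trace_map d h"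
  using trace_map_add[of "c - d" d h] by simp

section \<open>The group generated by the traces\<close>

lemma group_dual_group: "group (dual_group :: ('h \<Rightarrow> 'k) monoid)"
proof (rule groupI)
  fix x y :: "'h \<Rightarrow> 'k"
  assume "x \<in> carrier dual_group" "y \<in> carrier dual_group"
  then show "x \<otimes>\<^bsub>dual_group\<^esub> y \<in> carrier dual_group"
    by (simp add: dual_group_def Vector_Spaces.linear_iff algebra_simps)
next
  show "\<one>\<^bsub>dual_group\<^esub> \<in> carrier (dual_group :: ('h \<Rightarrow> 'k) monoid)"
    using vector_space_axioms by (auto simp: dual_group_def Vector_Spaces.linear_iff algebra_simps
        intro!: vector_space.intro)
next
  fix x :: "'h \<Rightarrow> 'k"
  assume "x \<in> carrier dual_group"
  then show "\<exists>y\<in>carrier dual_group. y \<otimes>\<^bsub>dual_group\<^esub> x = \<one>\<^bsub>dual_group\<^esub>"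
    by (intro bexI[of _ "\<lambda>h. - x h"]) (auto simp: dual_group_def Vector_Spaces.linear_iff)
qed (auto simp: dual_group_def algebra_simps)

lemma group_Z_group: "group (Z_group C)"
  unfolding Z_group_def by (rule group.group_subgroup_generated[OF group_dual_group])

lemma Z_group_operations:
  fixes x y :: "'h \<Rightarrow> 'k"
  shows "x \<otimes>\<^bsub>Z_group C\<^esub> y = (\<lambda>h. x h + y h)"
    and "\<one>\<^bsub>Z_group C\<^esub> = (\<lambda>h. 0 :: 'k)"
  by (simp_all add: Z_group_def dual_group_def)

lemma z_elem_in_Z_group:
  assumes "V \<in> C"
  shows "z_elem V \<in> carrier (Z_group C)"
  unfolding Z_group_def carrier_subgroup_generated
  by (rule generate.incl) (use assms z_elem_in_dual_group[OF objects fd] in auto)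

lemma trace_map_in_Z_group:
  assumes "Poly_Mapping.keys c \<subseteq> C"
  shows "trace_map c \<in> carrier (Z_group C)"
  using assms
proof (induction c rule: frag_induction)
  case zero
  show ?case
    using monoid.one_closed[OF group.is_monoid[OF group_Z_group]]
    by (simp add: Z_group_operations trace_map_zero[abs_def])
next
  case (one V)
  then show ?case
    by (simp add: trace_map_frag_of z_elem_in_Z_group)
next
  case (diff a b)
  \<comment> \<open>The subgroup supplies an inverse only abstractly; evaluating the equation
    pointwise identifies it as the negative of \<open>trace_map b\<close>.\<close>
  obtain y where y: "y \<in> carrier (Z_group C)" "y \<otimes>\<^bsub>Z_group C\<^esub> trace_map b = \<one>\<^bsub>Z_group C\<^esub>"
    using group.l_inv_ex[OF group_Z_group diff(2)] by blast
  then have "y h = - trace_map b h" for h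
    by (simp add: Z_group_operations fun_eq_iff eq_neg_iff_add_eq_0)
  then have "trace_map (a - b) = y \<otimes>\<^bsub>Z_group C\<^esub> trace_map a"
    by (simp add: Z_group_operations trace_map_diff fun_eq_iff)
  then show ?case
    using y(1) diff(1) group_Z_group by (simp add: group.is_monoid monoid.m_closed)
qed

lemma group_hom_trace_map: "group_hom F (Z_group C) trace_map"
proof (intro group_hom.intro group_hom_axioms.intro homI)
  show "group (Z_group C)"
    by (rule group_Z_group)
  show "trace_map c \<in> carrier (Z_group C)" if "c \<in> carrier F" for c
    using that trace_map_in_Z_group by simp
  show "trace_map (c \<otimes>\<^bsub>F\<^esub> d) = trace_map c \<otimes>\<^bsub>Z_group C\<^esub> trace_map d" for c d
    by (simp add: Z_group_def dual_group_def trace_map_add fun_eq_iff)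
qed simp

text \<open>The image is a subgroup of \<open>dual_group\<close> containing every generator
  \<open>z_elem V\<close>, hence it contains the subgroup they generate.\<close>

lemma trace_map_image: "trace_map ` carrier F = carrier (Z_group C)"
proof
  show "trace_map ` carrier F \<subseteq> carrier (Z_group C)"
    using trace_map_in_Z_group by auto
  interpret group_hom F "Z_group C" trace_map by (rule group_hom_trace_map)
  have "subgroup (trace_map ` carrier F) (subgroup_generated dual_group (z_elem ` C))"
    using img_is_subgroup by (simp add: Z_group_def)
  then have "subgroup (trace_map ` carrier F) dual_group"
    by (simp add: group.subgroup_subgroup_generated_iff[OF group_dual_group])
  moreover have "z_elem V \<in> trace_map ` carrier F" if "V \<in> C" for V
    using that trace_map_frag_of by (intro image_eqI[of _ _ "frag_of V"]) auto
  ultimately show "carrier (Z_group C) \<subseteq> trace_map ` carrier F"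
    unfolding Z_group_def carrier_subgroup_generated
    by (intro group.generate_subgroup_incl[OF group_dual_group]) auto
qed

lemma z_elem_short_exact:
  assumes C: "U \<in> C" "V \<in> C" "W \<in> C" and "short_exact C U V W"
  shows "z_elem V h = z_elem U h + z_elem W h"
proof -
  obtain f g where fg: "f \<in> Hom U V" "g \<in> Hom V W" "inj_on f (carrier U)"
    "f ` carrier U = {v \<in> carrier V. g v = \<zero>\<^bsub>W\<^esub>}" "g ` carrier V = carrier W"
    using short_exactE[OF assms(4) C] .
  show ?thesis
    by (rule z_elem_exact[OF objects fd objects fd objects fg]) (use C in auto)
qed

text \<open>The kernel is a subgroup, so the generating relations suffice, and these vanish by
  additivity of the trace.\<close>

lemma relations_subset_kernel: "R \<subseteq> kernel F (Z_group C) trace_map"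
proof -
  interpret group_hom F "Z_group C" trace_map by (rule group_hom_trace_map)
  have "frag_of V - frag_of U - frag_of W \<in> kernel F (Z_group C) trace_map"
    if "U \<in> C" "V \<in> C" "W \<in> C" "short_exact C U V W" for U V W
  proof -
    have "trace_map (frag_of V - frag_of U - frag_of W) = (\<lambda>h. 0)"
      using z_elem_short_exact[OF that] by (simp add: fun_eq_iff trace_map_diff trace_map_frag_of)
    moreover have "frag_of V - frag_of U - frag_of W \<in> carrier F"
      using subgroup.subset[OF subgroup_relations] K0_generator[OF that] by blast
    ultimately show ?thesis
      by (simp add: kernel_def Z_group_def dual_group_def)
  qed
  then show ?thesis
    unfolding K0_relations_def by (intro G.generate_subgroup_incl subgroup_kernel) auto
qed

section \<open>Reduction to simple objects and injectivity in characteristic zero\<close>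

context
  assumes char_0: "CHAR('k) = 0"
begin

lemma of_nat_eq_0_iff': "(of_nat n :: 'k) = 0 \<longleftrightarrow> n = 0"
  by (simp add: of_nat_eq_0_iff_char_dvd char_0)

lemma of_int_eq_0_iff': "(of_int k :: 'k) = 0 \<longleftrightarrow> k = 0"
  by (simp add: of_int_eq_0_iff_char_dvd char_0)

lemma of_nat_eq_add_iff: "(of_nat n :: 'k) = of_nat a + of_nat b \<longleftrightarrow> n = a + b"
proof -
  have "(of_nat n :: 'k) = of_nat a + of_nat b \<longleftrightarrow> (of_int (int n - int a - int b) :: 'k) = 0"
    by (simp add: algebra_simps)
  then show ?thesis
    unfolding of_int_eq_0_iff' by linarith
qed

text \<open>The dimension of \<open>V\<close>, read off as \<open>z\<^sub>V(1)\<close>, is the induction measure.\<close>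

lemma object_congruent_simple:
  assumes "V \<in> C" "z_elem V 1 = of_nat n"
  shows "\<exists>d. Poly_Mapping.keys d \<subseteq> {S \<in> C. simple_module S} \<and> frag_of V - d \<in> R"
  using assms
proof (induction n arbitrary: V rule: less_induct)
  case (less n V)
  note V = objects[OF less.prems(1)]
  interpret V: left_module V by (rule V)
  consider "carrier V = {\<zero>\<^bsub>V\<^esub>}" | "simple_module V"
    | U where "is_submodule U V" "U \<noteq> {\<zero>\<^bsub>V\<^esub>}" "U \<noteq> carrier V"
    using V unfolding simple_module_def by blast
  then show ?case
  proof cases
    case 1
    then show ?thesis
      using zero_module_relation less.prems(1) by (intro exI[of _ 0]) simp
  next
    case 2
    then show ?thesis
      using less.prems(1) relations_zero by (intro exI[of _ "frag_of V"]) simp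
  next
    case 3
    let ?U = "V\<lparr>carrier := U\<rparr>"
    have U: "?U \<in> C"
      by (rule submodule_object[OF less.prems(1) 3(1)])
    obtain W where W: "W \<in> C" "short_exact C ?U V W"
      and W0: "carrier W = {\<zero>\<^bsub>W\<^esub>} \<Longrightarrow> U = carrier V"
      using quotient_exists[OF less.prems(1) 3(1)] by blast
    obtain a where a: "z_elem ?U 1 = of_nat a" "a = 0 \<longleftrightarrow> carrier ?U = {\<zero>\<^bsub>?U\<^esub>}"
      using z_elem_one[OF objects fd, OF U U] .
    obtain b where b: "z_elem W 1 = of_nat b" "b = 0 \<longleftrightarrow> carrier W = {\<zero>\<^bsub>W\<^esub>}"
      using z_elem_one[OF objects fd, OF W(1) W(1)] .
    \<comment> \<open>Additivity of traces at 1 is an equation in the field; characteristic zero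
      lifts it to the natural numbers. As both pieces are nonzero, both are strictly smaller than
      \<open>V\<close>.\<close>
    have "n = a + b"
      using z_elem_short_exact[OF U less.prems(1) W, of 1] less.prems(2) a(1) b(1)
      by (simp add: of_nat_eq_add_iff)
    moreover have "a \<noteq> 0" "b \<noteq> 0"
      using a(2) b(2) W0 3 by auto
    ultimately have "a < n" "b < n"
      by simp_all
    then obtain d e where
      d: "Poly_Mapping.keys d \<subseteq> {S \<in> C. simple_module S}" "frag_of ?U - d \<in> R" and
      e: "Poly_Mapping.keys e \<subseteq> {S \<in> C. simple_module S}" "frag_of W - e \<in> R"
      using less.IH[OF _ U a(1)] less.IH[OF _ W(1) b(1)] by blast
    have "(frag_of V - frag_of ?U - frag_of W) + ((frag_of ?U - d) + (frag_of W - e)) \<in> R"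
      by (intro relations_add K0_generator U W d(2) e(2) less.prems(1))
    then have "frag_of V - (d + e) \<in> R"
      by (simp add: algebra_simps)
    moreover have "Poly_Mapping.keys (d + e) \<subseteq> {S \<in> C. simple_module S}"
      using Poly_Mapping.keys_add[of d e] d(1) e(1) by blast
    ultimately show ?thesis by blast
  qed
qed

lemma frag_congruent_simple:
  assumes "Poly_Mapping.keys c \<subseteq> C"
  shows "\<exists>d. Poly_Mapping.keys d \<subseteq> {S \<in> C. simple_module S} \<and> c - d \<in> R"
  using assms
proof (induction c rule: frag_induction)
  case zero
  show ?case
    using relations_zero by (intro exI[of _ 0]) simp
next
  case (one V)
  obtain n where "z_elem V 1 = of_nat n"
    using z_elem_one[OF objects fd, OF one one] by blast
  with one show ?case
    by (rule object_congruent_simple)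
next
  case (diff a b)
  then obtain d e where
    d: "Poly_Mapping.keys d \<subseteq> {S \<in> C. simple_module S}" "a - d \<in> R" and
    e: "Poly_Mapping.keys e \<subseteq> {S \<in> C. simple_module S}" "b - e \<in> R"
    by blast
  have "a - b - (d - e) \<in> R"
    using relations_diff[OF d(2) e(2)] by (simp add: algebra_simps)
  moreover have "Poly_Mapping.keys (d - e) \<subseteq> {S \<in> C. simple_module S}"
    using keys_diff[of d e] d(1) e(1) by blast
  ultimately show ?case by blast
qed

text \<open>A combination with as few simple objects as possible is taken: two isomorphic ones could
  be merged modulo \<open>R\<close>. This avoids choosing representatives of isomorphism
  classes.\<close>

lemma frag_congruent_nonisomorphic_simple:
  assumes "Poly_Mapping.keys c \<subseteq> C"
  obtains d where "Poly_Mapping.keys d \<subseteq> {S \<in> C. simple_module S}" "c - d \<in> R"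
    "\<And>S T. \<lbrakk>S \<in> Poly_Mapping.keys d; T \<in> Poly_Mapping.keys d; T \<noteq> S\<rbrakk> \<Longrightarrow> \<not> isomorphic T S"
proof -
  let ?P = "\<lambda>d. Poly_Mapping.keys d \<subseteq> {S \<in> C. simple_module S} \<and> c - d \<in> R"
  obtain d0 where "?P d0"
    using frag_congruent_simple[OF assms] by blast
  then obtain d where d: "?P d"
    and min: "\<And>d'. ?P d' \<Longrightarrow> card (Poly_Mapping.keys d) \<le> card (Poly_Mapping.keys d')"
    using ex_has_least_nat[of ?P d0 "\<lambda>d. card (Poly_Mapping.keys d)"] by blast
  have "\<not> isomorphic T S"
    if S: "S \<in> Poly_Mapping.keys d" and T: "T \<in> Poly_Mapping.keys d" and "T \<noteq> S" for S T
  proof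
    assume "isomorphic T S"
    define k where "k = Poly_Mapping.lookup d S"
    \<comment> \<open>The coefficient of \<open>S\<close> is transferred to \<open>T\<close>, so
      that \<open>S\<close> drops out of the support.\<close>
    define d' where "d' = d - frag_cmul k (frag_of S - frag_of T)"
    have lookup: "Poly_Mapping.lookup d' V = Poly_Mapping.lookup d V -
        k * ((if V = S then 1 else 0) - (if V = T then 1 else 0))" for V
      by (simp add: d'_def lookup_minus)
    have keys: "Poly_Mapping.keys d' \<subseteq> Poly_Mapping.keys d - {S}"
      using \<open>T \<noteq> S\<close> T by (auto simp: in_keys_iff lookup k_def split: if_splits)
    have "(c - d) + frag_cmul k (frag_of S - frag_of T) \<in> R"
      using d S T \<open>isomorphic T S\<close> by (intro relations_add relations_cmul isomorphic_relation) auto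
    then have "?P d'"
      using keys d by (auto simp: d'_def algebra_simps)
    then have "card (Poly_Mapping.keys d) \<le> card (Poly_Mapping.keys d - {S})"
      using min[of d'] card_mono[OF _ keys] by simp
    then show False
      using card_Diff1_less[OF _ S] by simp
  qed
  with d that show thesis by blast
qed

text \<open>Injectivity on the quotient. The combination \<open>d\<close> of nonisomorphic simple
  objects congruent to \<open>c\<close> turns out to be 0 itself, so that \<open>c = c - d\<close>
  is a relation.\<close>

lemma kernel_trace_map: "kernel F (Z_group C) trace_map = R"
proof
  show "kernel F (Z_group C) trace_map \<subseteq> R"
  proof
    fix c assume "c \<in> kernel F (Z_group C) trace_map"
    then have c: "Poly_Mapping.keys c \<subseteq> C" "\<And>h. trace_map c h = 0"
      by (simp_all add: kernel_def Z_group_def dual_group_def)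
    obtain d where d: "Poly_Mapping.keys d \<subseteq> {S \<in> C. simple_module S}" "c - d \<in> R"
      and noniso: "\<And>S T. \<lbrakk>S \<in> Poly_Mapping.keys d; T \<in> Poly_Mapping.keys d; T \<noteq> S\<rbrakk> \<Longrightarrow> \<not> isomorphic T S"
      using frag_congruent_nonisomorphic_simple[OF c(1)] by blast
    have "trace_map (c - d) h = 0" for h
      using relations_subset_kernel d(2) by (auto simp: kernel_def Z_group_def dual_group_def)
    then have trace_d: "trace_map d h = 0" for h
      using c(2) by (simp add: trace_map_diff)
    have "Poly_Mapping.keys d = {}"
    proof (rule equals0I)
      fix S assume S: "S \<in> Poly_Mapping.keys d"
      have props: "V \<in> C" "simple_module V" "left_module V" "finite_dimensional V"
          "finitely_annihilated V" if "V \<in> Poly_Mapping.keys d" for V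
        using that d(1) objects fd finite_dimensional_finitely_annihilated by auto
      obtain e where e: "\<And>v. v \<in> carrier S \<Longrightarrow> e \<odot>\<^bsub>S\<^esub> v = v"
        "\<And>M v. \<lbrakk>M \<in> Poly_Mapping.keys d - {S}; v \<in> carrier M\<rbrakk> \<Longrightarrow> e \<odot>\<^bsub>M\<^esub> v = \<zero>\<^bsub>M\<^esub>"
        using ex_separating_element[of S "Poly_Mapping.keys d - {S}"] props S noniso[OF S]
        by (metis Diff_iff finite_Diff finite_keys insertI1)
      interpret S: left_module S using props(3)[OF S] .
      have "trace_map d e = of_int (Poly_Mapping.lookup d S) * z_elem S e"
      proof -
        have "z_elem M e = 0" if "M \<in> Poly_Mapping.keys d - {S}" for M
          using that e(2) by (intro z_elem_eq_0 props) auto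
        then show ?thesis
          unfolding trace_map_def by (simp add: sum.remove[OF finite_keys S])
      qed
      also have "z_elem S e = z_elem S 1"
        using S e(1) by (intro z_elem_cong props) (auto simp: S.act_one)
      finally have "of_int (Poly_Mapping.lookup d S) * z_elem S 1 = 0"
        using trace_d by simp
      moreover obtain n where "z_elem S 1 = of_nat n" "n = 0 \<longleftrightarrow> carrier S = {\<zero>\<^bsub>S\<^esub>}"
        using z_elem_one[OF props(3,4)[OF S]] .
      moreover have "carrier S \<noteq> {\<zero>\<^bsub>S\<^esub>}"
        using props(2)[OF S] by (simp add: simple_module_def)
      ultimately have "Poly_Mapping.lookup d S = 0"
        by (simp add: of_nat_eq_0_iff' of_int_eq_0_iff')
      with S show False
        by (simp add: in_keys_iff)
    qed
    with d(2) show "c \<in> R"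
      by simp
  qed
qed (rule relations_subset_kernel)

lemma K0_iso_Z_group: "\<exists>\<phi>\<in>iso (K0 C) (Z_group C). \<forall>V\<in>C. \<phi> (K0_class C V) = z_elem V"
proof
  interpret group_hom F "Z_group C" trace_map by (rule group_hom_trace_map)
  \<comment> \<open>The map of the first isomorphism theorem: it takes the single value of
    \<open>trace_map\<close> on a coset.\<close>
  show "(\<lambda>X. the_elem (trace_map ` X)) \<in> iso (K0 C) (Z_group C)"
    using FactGroup_iso_set[OF trace_map_image] by (simp add: K0_def kernel_trace_map)
  have "trace_map ` K0_class C V = {z_elem V}" for V
  proof -
    have "trace_map (r + frag_of V) = z_elem V" if "r \<in> R" for r
      using that relations_subset_kernel
      by (auto simp: fun_eq_iff trace_map_add trace_map_frag_of kernel_def Z_group_def dual_group_def)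
    then have "trace_map ` (\<lambda>r. r + frag_of V) ` R = {z_elem V}"
      using relations_zero by (simp add: image_image) blast
    then show ?thesis
      by (simp add: K0_class_def r_coset_def UNION_singleton_eq_range)
  qed
  then show "\<forall>V\<in>C. the_elem (trace_map ` K0_class C V) = z_elem V"
    by simp
qed

end

end

theorem theorem1p3:
  fixes scale :: "'k::field \<Rightarrow> 'h::{ring,monoid_mult} \<Rightarrow> 'h"
    and C :: "('h, 'v) module set"
  assumes "CHAR('k) = 0"
    and "assoc_algebra scale"
    and "full_abelian_subcategory C"
    and "closed_under_submodules C"
    and "\<forall>V\<in>C. assoc_algebra.finite_dimensional scale V"
  shows "\<exists>\<phi>\<in>iso (K0 C) (assoc_algebra.Z_group scale C).
           \<forall>V\<in>C. \<phi> (K0_class C V) = assoc_algebra.z_elem scale V"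
proof -
  interpret finite_dimensional_subcategory scale C
    by (intro finite_dimensional_subcategory.intro closed_subcategory.intro
        closed_subcategory_axioms.intro finite_dimensional_subcategory_axioms.intro)
      (use assms in auto)
  show ?thesis
    by (rule K0_iso_Z_group[OF assms(1)])
qed

end
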